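(* Let $g\ge1$, $Q(x)=x^{2g+1}+P(x)\in\mathbf{Z}_p[x]$ with $\deg P\le2g$ and reduction mod $p$ squarefree, and let $P_1,\dots,P_L\in X(\mathbf{Q}_p)$ be affine points of $y^2=Q(x)$ with $y(P_\ell)\neq0$. Let $s\ge-1$ and $t\ge0$ be integers such that $D_H^t(s')\ne0$ for all $0\le s'\le s$, let $\omega\in W_{s,t}$ and let $h^t(s)=(\omega,0)\in W_{s,t}\times\mathbf{Q}_p^L$. Then the vector $$c(y^{-1})\,R_V(0,t)\,c(y^{2})\,R_H^t(-1,s)\,h^t(s)\in W_{-1,0}\times\mathbf{Q}_p^L$$ has projection onto $W_{-1,0}$ equal to some $\tilde\omega$ with $\tilde\omega=\omega-\mathrm{d}(g)$ for some $g\in A^\dagger\otimes\mathbf{Q}_p$, and projection onto $\mathbf{Q}_p^L$ equal to $(g(P_1),\dots,g(P_L))$.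
   Context: $A=\mathbf{Z}_p[x,y,y^{-1}]/(y^2-Q(x))$, $A^\dagger$ its weak completion, differentials satisfy $2y\,\mathrm{d}y=Q'(x)\mathrm{d}x$. For $s\ge-1,t\ge0$, $W_{s,t}=\{f(x)x^sy^{-2t}\mathrm{d}x/2y: f\in\mathbf{Q}_p[x],\deg f\le 2g\}$ (with $f(0)=0$ required when $s=-1$). An element of $W_{s,t}\times\mathbf{Q}_p^L$ is written in coordinates $(a_0,\dots,a_{2g},e_1,\dots,e_L)$, meaning $(\sum_{i=0}^{2g}a_ix^{i+s}y^{-2t}\mathrm{d}x/2y,\ (e_\ell))$. Horizontal: $D_H^t(s)=(2t-1)(2g+1)-2s$; $p_i^t(s)$ is the coefficient of $x^i$ in $2sP(x)-(2t-1)xP'(x)$; $M_H^t(s)$ is the $(2g+1+L)$-square matrix with rows/columns indexed $0,\dots,2g,1',\dots,L'$, whose nonzero entries are: $(i,i-1)$-entry $D_H^t(s)$ for $1\le i\le 2g$; $(i,2g)$-entry $p_i^t(s)$ for $0\le i\le 2g$; $(\ell',2g)$-entry $-1$; $(\ell',\ell')$-entry $x(P_\ell)D_H^t(s)$. $R_H^t(s)=M_H^t(s)/D_H^t(s)$; it maps coordinates of $W_{s,t}\times\mathbf{Q}_p^L$ to coordinates of $W_{s-1,t}\times\mathbf{Q}_p^L$. Vertical: for $0\le i\le 2g-1$ let $R_i,S_i\in\mathbf{Q}_p[x]$ with $x^i=R_iQ+S_iQ'$, $\deg R_i\le2g-1$, $\deg S_i\le 2g$; let $r_{i,j}$, $s'_{i,j}$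 be the coefficients of $x^j$ in $R_i$, $S_i'$. $D_V(t)=2t-1$; $M_V(t)$ is the $(2g+L)$-square matrix indexed $0,\dots,2g-1,1',\dots,L'$ with $(j,i)$-entry $(2t-1)r_{i,j}+2s'_{i,j}$, $(\ell',i)$-entry $-S_i(x(P_\ell))$, $(\ell',\ell')$-entry $y(P_\ell)^{-2}D_V(t)$, other entries $0$; $R_V(t)=M_V(t)/D_V(t)$, acting on $W_{-1,t}\times\mathbf{Q}_p^L$ written in coordinates $(a_0,\dots,a_{2g-1},e)$ meaning $\sum a_ix^iy^{-2t}\mathrm{d}x/2y$ (an element of $W_{-1,t}$ in horizontal coordinates $(0,a_1,\dots,a_{2g})$ is identified with vertical coordinates $(a_1,\dots,a_{2g})$). Interval products: $R(a,b)=R(a+1)R(a+2)\cdots R(b)$ (identity if $a=b$), for both $R_H^t$ and $R_V$. For a function $f$ on $X(\mathbf{Q}_p)$, the correction factor $c(f)$ is the linear map that is the identity on the differential component and multiplies the $\ell$-th component of $\mathbf{Q}_p^L$ by $f(P_\ell)$. *)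

theory Defs
  imports
    "HOL-Computational_Algebra.Computational_Algebra"
    "HOL-Algebra.QuotRing"
    "Berlekamp_Zassenhaus.Finite_Field"
    "Jordan_Normal_Form.Matrix"
begin

hide_const (open) up_ring.coeff up_ring.monom

section \<open>p-adic integers and numbers\<close>

text \<open>The prime is carried by the type argument, \<open>p = CARD('p)\<close>, as for \<open>'p mod_ring\<close>.
  A p-adic integer is a compatible sequence of residues \<open>f n \<in> {0..<p^n}\<close>, i.e. an element of
  the inverse limit of the rings \<open>Z/p^n\<close>.\<close>

typedef (overloaded) ('p :: prime_card) padic_int =
  "{f :: nat \<Rightarrow> int. \<forall>n. f (Suc n) mod int CARD('p) ^ n = f n}"
  by (rule exI[of _ "\<lambda>_. 0"]) simp

setup_lifting type_definition_padic_int

lemma padic_compatible: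
  fixes f :: "nat \<Rightarrow> int"
  assumes "\<forall>n. f (Suc n) mod p ^ n = f n" and "m \<le> n"
  shows "f n mod p ^ m = f m"
  using assms(2)
proof (induction n rule: dec_induct)
  case base
  show ?case by (metis assms(1) mod_mod_trivial)
next
  case (step n)
  have "f (Suc n) mod p ^ m = f (Suc n) mod p ^ n mod p ^ m"
    using step by (simp add: mod_mod_cancel le_imp_power_dvd)
  then show ?case using assms(1) step by metis
qed

lemma mod_power_Suc_mod: "(a :: int) mod p ^ Suc n mod p ^ n = a mod p ^ n"
  by (simp add: mod_mod_cancel)

instantiation padic_int :: (prime_card) comm_ring_1
begin

lift_definition zero_padic_int :: "'a padic_int" is "\<lambda>_. 0" by simp
lift_definition one_padic_int :: "'a padic_int" is "\<lambda>n. 1 mod int CARD('a) ^ n"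
  by (simp only: mod_power_Suc_mod)
lift_definition plus_padic_int :: "'a padic_int \<Rightarrow> 'a padic_int \<Rightarrow> 'a padic_int"
  is "\<lambda>f g n. (f n + g n) mod int CARD('a) ^ n"
  by (simp only: mod_power_Suc_mod) (metis mod_add_eq)
lift_definition minus_padic_int :: "'a padic_int \<Rightarrow> 'a padic_int \<Rightarrow> 'a padic_int"
  is "\<lambda>f g n. (f n - g n) mod int CARD('a) ^ n"
  by (simp only: mod_power_Suc_mod) (metis mod_diff_eq)
lift_definition uminus_padic_int :: "'a padic_int \<Rightarrow> 'a padic_int"
  is "\<lambda>f n. (- f n) mod int CARD('a) ^ n"
  by (simp only: mod_power_Suc_mod) (metis mod_minus_eq)
lift_definition times_padic_int :: "'a padic_int \<Rightarrow> 'a padic_int \<Rightarrow> 'a padic_int"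
  is "\<lambda>f g n. (f n * g n) mod int CARD('a) ^ n"
  by (simp only: mod_power_Suc_mod) (metis mod_mult_eq)

instance
proof
  fix a b c :: "'a padic_int"
  show "a * b * c = a * (b * c)"
    by transfer (simp add: fun_eq_iff mod_mult_left_eq mod_mult_right_eq mult.assoc)
  show "a * b = b * a" by transfer (simp add: mult.commute)
  show "1 * a = a"
    by transfer (simp add: fun_eq_iff mod_mult_left_eq, metis mod_mod_trivial)
  show "a + b + c = a + (b + c)"
    by transfer (simp add: fun_eq_iff mod_add_left_eq mod_add_right_eq add.assoc)
  show "a + b = b + a" by transfer (simp add: add.commute)
  show "0 + a = a" by transfer (simp add: fun_eq_iff, metis mod_mod_trivial)
  show "- a + a = 0" by transfer (simp add: fun_eq_iff mod_add_left_eq)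
  show "a - b = a + - b" by transfer (simp add: fun_eq_iff mod_add_right_eq)
  show "(a + b) * c = a * c + b * c"
    by transfer (simp add: fun_eq_iff mod_mult_left_eq mod_add_eq distrib_right)
  show "(0 :: 'a padic_int) \<noteq> 1"
  proof (transfer, rule notI)
    assume "(\<lambda>_. 0) = (\<lambda>n. 1 mod int CARD('a) ^ n)"
    then have "0 = 1 mod int CARD('a) ^ 1" by metis
    moreover have "int CARD('a) > 1"
      using prime_card[where 'a = 'a] prime_gt_1_nat by fastforce
    ultimately show False by simp
  qed
qed

end

instance padic_int :: (prime_card) idom
proof
  fix a b :: "'a padic_int"
  assume "a \<noteq> 0" "b \<noteq> 0"
  then show "a * b \<noteq> 0"
  proof transfer
    fix f g :: "nat \<Rightarrow> int"
    let ?p = "int CARD('a)"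
    assume f: "\<forall>n. f (Suc n) mod ?p ^ n = f n" and g: "\<forall>n. g (Suc n) mod ?p ^ n = g n"
    assume "f \<noteq> (\<lambda>_. 0)" "g \<noteq> (\<lambda>_. 0)"
    then obtain m n where m: "f m \<noteq> 0" and n: "g n \<noteq> 0" by blast
    show "(\<lambda>n. f n * g n mod ?p ^ n) \<noteq> (\<lambda>_. 0)"
    proof
      assume "(\<lambda>n. f n * g n mod ?p ^ n) = (\<lambda>_. 0)"
      then have *: "?p ^ (m + n) dvd f (m + n) * g (m + n)"
        by (metis mod_0_imp_dvd)
      have nd: "\<not> ?p ^ m dvd f (m + n)" "\<not> ?p ^ n dvd g (m + n)"
        using m n padic_compatible[OF f, of m "m + n"] padic_compatible[OF g, of n "m + n"]
        by (auto dest: dvd_imp_mod_0)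
      then have nz: "f (m + n) \<noteq> 0" "g (m + n) \<noteq> 0" by auto
      have p: "prime_elem ?p" using prime_card_int[where 'a = 'a] by simp
      have "m + n \<le> multiplicity ?p (f (m + n) * g (m + n))"
        using * nz p by (subst power_dvd_iff_le_multiplicity [symmetric]) auto
      also have "\<dots> = multiplicity ?p (f (m + n)) + multiplicity ?p (g (m + n))"
        using p nz by (rule prime_elem_multiplicity_mult_distrib)
      finally show False
        using nd by (metis add_mono_thms_linordered_field(5) multiplicity_dvd' not_less)
    qed
  qed
qed

lift_definition padic_residue :: "'p :: prime_card padic_int \<Rightarrow> 'p mod_ring"
  is "\<lambda>f. of_int_mod_ring (f 1)" .

type_synonym 'p padic = "'p padic_int fract"

definition padic_ball :: "nat \<Rightarrow> 'p :: prime_card padic set" where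
  "padic_ball n = range (\<lambda>z. of_nat CARD('p) ^ n * to_fract z)"

section \<open>The curve and its overconvergent functions\<close>

text \<open>A power series \<open>F\<close> in \<open>X, Y, Z\<close> is a triply nested \<^typ>\<open>'a fps\<close>, with \<open>X\<close> outermost.\<close>

type_synonym 'a fps3 = "'a fps fps fps"

definition coeff3 :: "'a fps3 \<Rightarrow> nat \<Rightarrow> nat \<Rightarrow> nat \<Rightarrow> 'a" where
  "coeff3 F i j k = fps_nth (fps_nth (fps_nth F i) j) k"

abbreviation const3 :: "'a :: zero \<Rightarrow> 'a fps3" where
  "const3 c \<equiv> fps_const (fps_const (fps_const c))"
abbreviation X3 :: "'a :: comm_ring_1 fps3" where "X3 \<equiv> fps_X"
abbreviation Y3 :: "'a :: comm_ring_1 fps3" where "Y3 \<equiv> fps_const fps_X"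
abbreviation Z3 :: "'a :: comm_ring_1 fps3" where "Z3 \<equiv> fps_const (fps_const fps_X)"

definition dX3 :: "'a :: comm_ring_1 fps3 \<Rightarrow> 'a fps3" where
  "dX3 F = fps_deriv F"
definition dY3 :: "'a :: comm_ring_1 fps3 \<Rightarrow> 'a fps3" where
  "dY3 F = Abs_fps (\<lambda>i. fps_deriv (fps_nth F i))"
definition dZ3 :: "'a :: comm_ring_1 fps3 \<Rightarrow> 'a fps3" where
  "dZ3 F = Abs_fps (\<lambda>i. Abs_fps (\<lambda>j. fps_deriv (fps_nth (fps_nth F i) j)))"

definition poly3 :: "'a :: comm_ring_1 poly \<Rightarrow> 'a fps3" where
  "poly3 f = (\<Sum>i\<le>degree f. const3 (coeff f i) * X3 ^ i)"

text \<open>The weak completion of \<open>Z_p[X,Y,Z]\<close> in the sense of Monsky and Washnitzer: the sums of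
  polynomials \<open>h_m \<in> p^m Z_p[X,Y,Z]\<close> with \<open>deg h_m \<le> C (m + 1)\<close>. In terms of coefficients this
  says that the terms of total degree at least \<open>C n\<close> are divisible by \<open>p^n\<close> (for a possibly
  different \<open>C\<close>); \<open>n = 0\<close> gives integrality.\<close>

definition dagger_int :: "'p :: prime_card padic fps3 set" where
  "dagger_int = {F. \<exists>C. \<forall>n i j k. C * n \<le> i + j + k \<longrightarrow> coeff3 F i j k \<in> padic_ball n}"

definition dagger_rat :: "'p :: prime_card padic fps3 set" where
  "dagger_rat = {F. \<exists>m. const3 (of_nat CARD('p) ^ m) * F \<in> dagger_int}"

definition dagger_ring :: "'p :: prime_card padic fps3 ring" where
  "dagger_ring = \<lparr>carrier = dagger_rat, monoid.mult = (*), one = 1, zero = 0, add = (+)\<rparr>"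

abbreviation ratpoly :: "'p :: prime_card padic_int poly \<Rightarrow> 'p padic poly" where
  "ratpoly \<equiv> map_poly to_fract"

definition curve_ideal :: "'p :: prime_card padic_int poly \<Rightarrow> 'p padic fps3 set" where
  "curve_ideal Q = Idl\<^bsub>dagger_ring\<^esub> {Y3 ^ 2 - poly3 (ratpoly Q), Y3 * Z3 - 1}"

text \<open>The weak completion of \<open>A = Z_p[X,Y,Z]/(Y^2 - Q, Y Z - 1)\<close> is the quotient of the weak
  completion of \<open>Z_p[X,Y,Z]\<close> by the ideal with the same generators. As tensoring with \<open>Q_p\<close> is
  exact, the quotient below is \<open>A\<^sup>\<dagger> \<otimes> Q_p\<close>.\<close>

definition dagger_algebra :: "'p :: prime_card padic_int poly \<Rightarrow> 'p padic fps3 set ring" where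
  "dagger_algebra Q = dagger_ring Quot curve_ideal Q"

definition dagger_class :: "'p :: prime_card padic_int poly \<Rightarrow> 'p padic fps3 \<Rightarrow> 'p padic fps3 set" where
  "dagger_class Q F = curve_ideal Q +>\<^bsub>dagger_ring\<^esub> F"

text \<open>Since \<open>y\<close> is a unit and \<open>2y dy = Q'(x) dx\<close>, the differentials over \<open>A\<^sup>\<dagger> \<otimes> Q_p\<close> are free on
  \<open>dx/2y\<close>; the differential \<open>f dx/2y\<close> is represented by \<open>f\<close>. In this basis \<open>dx\<close>, \<open>dy\<close> and
  \<open>d(y\<^sup>-\<^sup>1) = -y\<^sup>-\<^sup>2 dy\<close> are \<open>2y\<close>, \<open>Q'(x)\<close> and \<open>-y\<^sup>-\<^sup>2 Q'(x)\<close>.\<close>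

definition d_series :: "'p :: prime_card padic_int poly \<Rightarrow> 'p padic fps3 \<Rightarrow> 'p padic fps3" where
  "d_series Q F = 2 * Y3 * dX3 F + poly3 (ratpoly (pderiv Q)) * dY3 F
     - Z3 ^ 2 * poly3 (ratpoly (pderiv Q)) * dZ3 F"

definition d_dagger ::
  "'p :: prime_card padic_int poly \<Rightarrow> 'p padic fps3 set \<Rightarrow> 'p padic fps3 set" where
  "d_dagger Q G = the_elem ((\<lambda>F. dagger_class Q (d_series Q F)) ` G)"

definition affine_points :: "'p :: prime_card padic_int poly \<Rightarrow> ('p padic \<times> 'p padic) set" where
  "affine_points Q = {(x, y). y ^ 2 = poly (ratpoly Q) x}"

text \<open>\<open>dagger_value G (x, y) e\<close>: the function \<open>G \<in> A\<^sup>\<dagger> \<otimes> Q_p\<close> is defined at \<open>(x, y)\<close> and has value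
  \<open>e\<close> there. Points with \<open>|y| \<noteq> 1\<close> lie outside the affinoid on which every element of
  \<open>A\<^sup>\<dagger>\<close> converges. So some representing series is required to converge on a polydisc containing
  both the unit polydisc and \<open>(x, y, 1/y)\<close>, i.e. with radii \<open>max 1 |x|\<close>, \<open>max 1 |y|\<close> and
  \<open>max 1 |1/y|\<close>; this is the condition on \<open>u\<close>, \<open>v\<close>, \<open>w\<close>. Convergence at \<open>(x, y, 1/y)\<close> alone
  would not determine the value: if \<open>x = 0\<close> and \<open>|y| < 1\<close>, then \<open>1 = Q(0) Z^2\<close> modulo \<open>X\<close> and the
  ideal, and \<open>1 - Q(0) Z^2\<close> is invertible, so the ideal has an element of the form \<open>1 + X H\<close>.\<close>

definition dagger_value ::
  "'p :: prime_card padic fps3 set \<Rightarrow> 'p padic \<times> 'p padic \<Rightarrow> 'p padic \<Rightarrow> bool" where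
  "dagger_value G pt e \<longleftrightarrow> (case pt of (x, y) \<Rightarrow> \<exists>F\<in>G.
     (\<forall>u\<in>{1, x}. \<forall>v\<in>{1, y}. \<forall>w\<in>{1, 1 / y}. \<forall>n.
        finite {(i, j, k). coeff3 F i j k * u ^ i * v ^ j * w ^ k \<notin> padic_ball n}) \<and>
     (\<forall>n. \<forall>\<^sub>F B in finite_sets_at_top.
        (\<Sum>(i, j, k)\<in>B. coeff3 F i j k * x ^ i * y ^ j * (1 / y) ^ k) - e \<in> padic_ball n))"

section \<open>Reduction maps\<close>

text \<open>\<open>diff_form Q s t f\<close> is \<open>f(x) x\<^sup>s y\<^sup>-\<^sup>2\<^sup>t dx/2y\<close>; for \<open>s = -1\<close> it is only used when \<open>f(0) = 0\<close>.\<close>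

definition diff_form ::
  "'p :: prime_card padic_int poly \<Rightarrow> int \<Rightarrow> nat \<Rightarrow> 'p padic poly \<Rightarrow> 'p padic fps3 set" where
  "diff_form Q s t f = dagger_class Q
     (\<Sum>i\<le>degree f. const3 (coeff f i) * X3 ^ nat (int i + s) * Z3 ^ (2 * t))"

definition W_space ::
  "nat \<Rightarrow> 'p :: prime_card padic_int poly \<Rightarrow> int \<Rightarrow> nat \<Rightarrow> 'p padic fps3 set set" where
  "W_space g Q s t =
     {diff_form Q s t f | f. degree f \<le> 2 * g \<and> (s = -1 \<longrightarrow> coeff f 0 = 0)}"

text \<open>In both coordinate systems the index \<open>\<ell>'\<close> (for \<open>\<ell> = 1, \<dots>, L\<close>) comes after the polynomial
  indices; points are numbered \<open>0, \<dots>, L - 1\<close>. The following two functions give the element of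
  \<open>W_space g Q s t \<times> Q_p\<^sup>L\<close>, respectively \<open>W_space g Q (-1) t \<times> Q_p\<^sup>L\<close>, with given coordinates.\<close>

definition from_horizontal ::
  "nat \<Rightarrow> nat \<Rightarrow> 'p :: prime_card padic_int poly \<Rightarrow> int \<Rightarrow> nat \<Rightarrow> 'p padic vec
     \<Rightarrow> 'p padic fps3 set \<times> 'p padic vec" where
  "from_horizontal g L Q s t v =
     (diff_form Q s t (\<Sum>i\<le>2 * g. monom (vec_index v i) i),
      vec L (\<lambda>l. vec_index v (2 * g + 1 + l)))"

definition from_vertical ::
  "nat \<Rightarrow> nat \<Rightarrow> 'p :: prime_card padic_int poly \<Rightarrow> nat \<Rightarrow> 'p padic vec
     \<Rightarrow> 'p padic fps3 set \<times> 'p padic vec" where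
  "from_vertical g L Q t v =
     (diff_form Q 0 t (\<Sum>i<2 * g. monom (vec_index v i) i),
      vec L (\<lambda>l. vec_index v (2 * g + l)))"

text \<open>Horizontal coordinates \<open>(0, a\<^sub>1, \<dots>, a\<^sub>2\<^sub>g, e)\<close> of an element of \<open>W_space g Q (-1) t \<times> Q_p\<^sup>L\<close>
  become vertical coordinates \<open>(a\<^sub>1, \<dots>, a\<^sub>2\<^sub>g, e)\<close>.\<close>

definition horizontal_to_vertical :: "nat \<Rightarrow> nat \<Rightarrow> 'a vec \<Rightarrow> 'a vec" where
  "horizontal_to_vertical g L v = vec (2 * g + L) (\<lambda>i. vec_index v (i + 1))"

definition D_H :: "nat \<Rightarrow> nat \<Rightarrow> int \<Rightarrow> int" where
  "D_H g t s = (2 * int t - 1) * (2 * int g + 1) - 2 * s"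

definition p_H :: "'p :: prime_card padic_int poly \<Rightarrow> nat \<Rightarrow> int \<Rightarrow> nat \<Rightarrow> 'p padic" where
  "p_H P t s i = to_fract (coeff (of_int (2 * s) * P
     - of_int (2 * int t - 1) * (monom 1 1 * pderiv P)) i)"

definition M_H :: "nat \<Rightarrow> nat \<Rightarrow> 'p :: prime_card padic_int poly \<Rightarrow> (nat \<Rightarrow> 'p padic \<times> 'p padic)
    \<Rightarrow> nat \<Rightarrow> int \<Rightarrow> 'p padic mat" where
  "M_H g L P pt t s = mat (2 * g + 1 + L) (2 * g + 1 + L) (\<lambda>(i, j).
     if i \<le> 2 * g then
       (if j = 2 * g then p_H P t s i else if i = j + 1 then of_int (D_H g t s) else 0)
     else
       (if j = 2 * g then -1
        else if i = j then fst (pt (i - (2 * g + 1))) * of_int (D_H g t s) else 0))"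

definition R_H :: "nat \<Rightarrow> nat \<Rightarrow> 'p :: prime_card padic_int poly \<Rightarrow> (nat \<Rightarrow> 'p padic \<times> 'p padic)
    \<Rightarrow> nat \<Rightarrow> int \<Rightarrow> 'p padic mat" where
  "R_H g L P pt t s = (1 / of_int (D_H g t s)) \<cdot>\<^sub>m M_H g L P pt t s"

definition D_V :: "int \<Rightarrow> int" where
  "D_V t = 2 * t - 1"

definition M_V :: "nat \<Rightarrow> nat \<Rightarrow> (nat \<Rightarrow> 'p padic poly) \<Rightarrow> (nat \<Rightarrow> 'p padic poly)
    \<Rightarrow> (nat \<Rightarrow> 'p padic \<times> 'p padic) \<Rightarrow> int \<Rightarrow> 'p :: prime_card padic mat" where
  "M_V g L R S pt t = mat (2 * g + L) (2 * g + L) (\<lambda>(j, i).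
     if j < 2 * g then
       (if i < 2 * g then of_int (2 * t - 1) * coeff (R i) j + 2 * coeff (pderiv (S i)) j else 0)
     else
       (if i < 2 * g then - poly (S i) (fst (pt (j - 2 * g)))
        else if i = j then of_int (D_V t) / snd (pt (j - 2 * g)) ^ 2 else 0))"

definition R_V :: "nat \<Rightarrow> nat \<Rightarrow> (nat \<Rightarrow> 'p padic poly) \<Rightarrow> (nat \<Rightarrow> 'p padic poly)
    \<Rightarrow> (nat \<Rightarrow> 'p padic \<times> 'p padic) \<Rightarrow> int \<Rightarrow> 'p :: prime_card padic mat" where
  "R_V g L R S pt t = (1 / of_int (D_V t)) \<cdot>\<^sub>m M_V g L R S pt t"

definition interval_product :: "nat \<Rightarrow> (int \<Rightarrow> 'a :: semiring_1 mat) \<Rightarrow> int \<Rightarrow> int \<Rightarrow> 'a mat" where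
  "interval_product n M a b = foldr (\<lambda>k N. M k * N) [a + 1..b] (1\<^sub>m n)"

definition correction ::
  "nat \<Rightarrow> nat \<Rightarrow> (nat \<Rightarrow> 'b) \<Rightarrow> ('b \<Rightarrow> 'a) \<Rightarrow> 'a :: semiring_1 mat" where
  "correction n L pt f = mat (n + L) (n + L) (\<lambda>(i, j).
     if i \<noteq> j then 0 else if i < n then 1 else f (pt (i - n)))"

end

theory Submission
  imports Defs
begin

text \<open>
  Every reduction step subtracts an explicit exact differential: from
  \<open>d(f(x) y\<^sup>1\<^sup>-\<^sup>2\<^sup>t) = (2 f' Q - (2t-1) f Q') y\<^sup>-\<^sup>2\<^sup>t dx/2y\<close>, the choice \<open>f = x\<^sup>s\<close> removes the top
  coefficient of an element of \<open>W\<^sub>s\<^sub>,\<^sub>t\<close> (horizontal step), and the choice \<open>f = \<Sum> a\<^sub>i S\<^sub>i\<close> lowers the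
  pole order \<open>2t\<close> (vertical step). The last \<open>L\<close> coordinates record the values at the points of the
  functions subtracted so far, up to the powers of \<open>x\<close> and \<open>y\<close> that the diagonal entries and the
  correction factors restore. The total function is a polynomial in \<open>x\<close>, \<open>y\<close>, \<open>y\<^sup>-\<^sup>1\<close>, so its values
  are finite sums and no convergence question arises. What remains is that \<open>d\<close> descends to the
  quotient defining \<open>A\<^sup>\<dagger>\<close> and that polynomials with coefficients in \<open>Frac Z\<^sub>p\<close> are overconvergent,
  i.e. that every nonzero p-adic integer divides a power of \<open>p\<close>.
\<close>

section \<open>p-adic numbers\<close>

lemma Rep_padic_int_of_nat:
  "Rep_padic_int (of_nat m :: 'p :: prime_card padic_int) n = int m mod int CARD('p) ^ n"
proof (induction m)
  case 0
  show ?case by (simp add: zero_padic_int.rep_eq)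
next
  case (Suc m)
  then show ?case
    by (simp add: plus_padic_int.rep_eq one_padic_int.rep_eq mod_add_eq)
qed

lemma Rep_padic_int_of_int:
  "Rep_padic_int (of_int m :: 'p :: prime_card padic_int) n = m mod int CARD('p) ^ n"
proof (cases m)
  case (nonneg k)
  then show ?thesis by (simp add: Rep_padic_int_of_nat)
next
  case (neg k)
  have "(of_int m :: 'p padic_int) = - of_nat (Suc k)"
    by (simp only: neg of_int_minus of_int_of_nat_eq)
  then show ?thesis
    by (simp only: uminus_padic_int.rep_eq Rep_padic_int_of_nat neg mod_minus_eq)
qed

lemma card_prime_gt_1: "int CARD('p :: prime_card) > 1"
  using prime_card[where 'a = 'p] prime_gt_1_nat by fastforce

text \<open>The residue at level \<open>|m|\<close> decides, since \<open>|m| < p ^ |m|\<close>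
  leaves 0 as the only such multiple of \<open>p ^ |m|\<close>. Characteristic zero is what later
  permits division by \<open>D_H\<close> and \<open>D_V\<close>.\<close>

lemma of_int_padic_int_eq_0_iff [simp]:
  "(of_int m :: 'p :: prime_card padic_int) = 0 \<longleftrightarrow> m = 0"
proof
  assume "(of_int m :: 'p padic_int) = 0"
  then have "m mod int CARD('p) ^ nat \<bar>m\<bar> = 0"
    by (metis Rep_padic_int_of_int zero_padic_int.rep_eq)
  then have "int CARD('p) ^ nat \<bar>m\<bar> dvd m" by presburger
  moreover have "\<bar>m\<bar> < int CARD('p) ^ nat \<bar>m\<bar>"
  proof -
    have "nat \<bar>m\<bar> < CARD('p) ^ nat \<bar>m\<bar>"
      using card_prime_gt_1[where 'p = 'p] by (intro power_gt_expt) simp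
    then have "int (nat \<bar>m\<bar>) < int (CARD('p) ^ nat \<bar>m\<bar>)" by (simp only: of_nat_less_iff)
    then show ?thesis by simp
  qed
  ultimately show "m = 0" by (meson dvd_imp_le_int linorder_not_less order_le_less_trans abs_ge_self)
qed simp

lemma to_fract_of_nat: "to_fract (of_nat n) = of_nat n"
  by (induction n) simp_all

lemma to_fract_of_int: "to_fract (of_int m) = of_int m"
  by (cases m) (simp_all add: to_fract_of_nat)

lemma to_fract_power: "to_fract (x ^ n) = to_fract x ^ n"
  by (induction n) simp_all

lemma of_int_padic_eq_0_iff [simp]: "(of_int m :: 'p :: prime_card padic) = 0 \<longleftrightarrow> m = 0"
  by (metis of_int_padic_int_eq_0_iff to_fract_of_int to_fract_eq_0_iff)

text \<open>Write \<open>b\<close> as \<open>p ^ m\<close> times a unit; the inverse of the unit is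
  assembled from inverses modulo each \<open>p ^ N\<close>.\<close>

lemma padic_int_dvd_prime_power:
  fixes b :: "'p :: prime_card padic_int"
  assumes "b \<noteq> 0"
  shows "\<exists>m. b dvd of_nat CARD('p) ^ m"
proof -
  define p where "p = int CARD('p)"
  define f where "f = Rep_padic_int b"
  have p: "prime p" "p > 1" unfolding p_def by (rule prime_card_int) (rule card_prime_gt_1)
  have f: "\<forall>n. f (Suc n) mod p ^ n = f n"
    using Rep_padic_int[of b] unfolding f_def p_def by blast
  note comp = padic_compatible[OF f]
  have "f \<noteq> (\<lambda>_. 0)"
  proof
    assume "f = (\<lambda>_. 0)"
    then have "Rep_padic_int b = Rep_padic_int (0 :: 'p padic_int)"
      unfolding f_def zero_padic_int.rep_eq .
    then show False using assms unfolding Rep_padic_int_inject by contradiction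
  qed
  then have ex: "\<exists>n. f n \<noteq> 0" by blast
  \<comment> \<open>The valuation of \<open>b\<close>. Since \<open>f 0 = 0\<close>, the least index
    is positive and the subtraction does not truncate.\<close>
  define m where "m = (LEAST n. f n \<noteq> 0) - 1"
  have f0: "f 0 = 0" using comp[of 0 0] by simp
  have "(LEAST n. f n \<noteq> 0) \<noteq> 0" using LeastI_ex[OF ex] f0 by metis
  then have Lm: "(LEAST n. f n \<noteq> 0) = Suc m" by (simp add: m_def)
  have fSm: "f (Suc m) \<noteq> 0" using LeastI_ex[OF ex] Lm by simp
  have fm: "f m = 0" using not_less_Least[of m "\<lambda>n. f n \<noteq> 0"] Lm by simp
  \<comment> \<open>Level \<open>N\<close> of the unit part needs level \<open>N + m\<close> of
    \<open>b\<close>, because division by \<open>p ^ m\<close> uses up \<open>m\<close>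
    digits.\<close>
  define u where "u N = f (N + m) div p ^ m" for N
  have fu: "f (N + m) = p ^ m * u N" for N
    using comp[of m "N + m"] fm by (simp add: u_def dvd_eq_mod_eq_0)
  have u_mod: "u (Suc N) mod p ^ N = u N mod p ^ N" for N
  proof -
    have "f (Suc N + m) mod p ^ (N + m) = f (N + m) mod p ^ (N + m)"
      using comp[of "N + m" "Suc N + m"] comp[of "N + m" "N + m"] by simp
    then have "p ^ m * (u (Suc N) mod p ^ N) = p ^ m * (u N mod p ^ N)"
      by (simp only: fu power_add mult.commute[of "p ^ N"] mod_mult_mult1)
    then show ?thesis using p by simp
  qed
  have cop: "coprime (u N) (p ^ N)" for N
  proof (cases "N = 0")
    case False
    have "\<not> p dvd u N"
    proof
      assume "p dvd u N"
      then have "p ^ Suc m dvd f (N + m)" by (simp add: fu mult_dvd_mono mult.commute)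
      then show False using comp[of "Suc m" "N + m"] False fSm by simp
    qed
    then show ?thesis using p by (simp add: coprime_commute prime_imp_coprime)
  qed simp
  \<comment> \<open>Bezout gives an inverse at each level. Choosing it reduced makes it unique, so
    the choices at different levels are compatible.\<close>
  have "\<exists>d. u N * d mod p ^ N = 1 mod p ^ N \<and> d mod p ^ N = d" for N
  proof -
    obtain x y where "x * u N + y * p ^ N = 1"
      using bezout_int[of "u N" "p ^ N"] cop[of N] by (auto simp: coprime_iff_gcd_eq_1)
    then have "u N * x mod p ^ N = 1 mod p ^ N"
      by (metis mod_mult_self1 mult.commute)
    then show ?thesis by (intro exI[of _ "x mod p ^ N"]) (simp add: mod_mult_right_eq)
  qed
  then obtain d where d: "u N * d N mod p ^ N = 1 mod p ^ N" "d N mod p ^ N = d N" for N by metis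
  have d_comp: "d (Suc N) mod p ^ N = d N" for N
  proof -
    have "u N * d (Suc N) mod p ^ N = 1 mod p ^ N"
      by (metis d(1) mod_mult_left_eq mod_power_Suc_mod u_mod)
    then have "u N * d (Suc N) mod p ^ N = u N * d N mod p ^ N" using d(1) by simp
    then have "p ^ N dvd u N * (d (Suc N) - d N)"
      by (simp add: mod_eq_dvd_iff right_diff_distrib)
    then have "p ^ N dvd d (Suc N) - d N"
      using cop[of N] by (simp add: coprime_commute coprime_dvd_mult_right_iff)
    then show ?thesis using d(2)[of N] by (metis mod_eq_dvd_iff)
  qed
  then have d': "Rep_padic_int (Abs_padic_int d :: 'p padic_int) = d"
    by (intro Abs_padic_int_inverse) (simp add: p_def)
  have "f N * d N mod p ^ N = p ^ m mod p ^ N" for N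
  proof -
    have "f N * d N mod p ^ N = f (N + m) * d N mod p ^ N"
      by (metis comp le_add1 mod_mult_left_eq)
    also have "\<dots> = p ^ m * (u N * d N mod p ^ N) mod p ^ N"
      by (simp add: fu mod_mult_right_eq mult.assoc)
    finally show ?thesis by (simp add: d(1) mod_mult_right_eq)
  qed
  then have "Rep_padic_int (b * Abs_padic_int d) n
      = Rep_padic_int (of_nat (CARD('p) ^ m) :: 'p padic_int) n" for n
    by (simp only: times_padic_int.rep_eq d' Rep_padic_int_of_nat flip: f_def)
      (simp only: of_nat_power flip: p_def)
  then have "Rep_padic_int (b * Abs_padic_int d) = Rep_padic_int (of_nat (CARD('p) ^ m) :: 'p padic_int)"
    by (rule ext)
  then have "b * Abs_padic_int d = of_nat CARD('p) ^ m"
    by (simp add: Rep_padic_int_inject)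
  then show ?thesis by (metis dvd_triv_left)
qed

text \<open>The fraction field only needs denominators that are powers of p: multiply numerator and
  denominator by the cofactor of \<open>b\<close> in \<open>p ^ m\<close>.\<close>

lemma padic_eq_fraction:
  fixes c :: "'p :: prime_card padic"
  obtains m z where "of_nat CARD('p) ^ m * c = to_fract z"
proof -
  obtain a b where c: "c = Fract a b" "b \<noteq> 0" by (cases c)
  obtain m d where d: "of_nat CARD('p) ^ m = b * d"
    using padic_int_dvd_prime_power[OF c(2)] by (auto elim: dvdE)
  have "of_nat CARD('p) ^ m * c = to_fract (d * a)"
    using arg_cong[OF d, of to_fract] c
    by (simp add: to_fract_power to_fract_of_nat Fract_conv_to_fract)
  then show ?thesis by (rule that)
qed

section \<open>Arithmetic of the balls \<open>p ^ n * Z_p\<close>\<close>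

lemma padic_ball_0: "padic_ball 0 = range to_fract"
  by (simp add: padic_ball_def)

lemma padic_ball_memI: "of_nat CARD('p) ^ n * to_fract z \<in> (padic_ball n :: 'p :: prime_card padic set)"
  unfolding padic_ball_def by (rule rangeI)

lemma padic_ballE:
  assumes "(x :: 'p :: prime_card padic) \<in> padic_ball n"
  obtains z where "x = of_nat CARD('p) ^ n * to_fract z"
  using assms unfolding padic_ball_def by (rule rangeE)

lemma zero_in_padic_ball [simp]: "0 \<in> padic_ball n"
  unfolding padic_ball_def by (rule range_eqI[of _ _ 0]) simp

lemma padic_ball_add:
  assumes "x \<in> padic_ball n" "y \<in> padic_ball n"
  shows "x + y \<in> padic_ball n"
  using assms by (elim padic_ballE) (metis distrib_left to_fract_add padic_ball_memI)

lemma padic_ball_sum: "(\<And>i. i \<in> A \<Longrightarrow> f i \<in> padic_ball n) \<Longrightarrow> sum f A \<in> padic_ball n"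
  by (induction A rule: infinite_finite_induct) (simp_all add: padic_ball_add)

lemma padic_ball_mult:
  assumes "x \<in> padic_ball m" "y \<in> padic_ball n"
  shows "x * y \<in> padic_ball (m + n)"
proof -
  obtain z w where "x = of_nat CARD('a) ^ m * to_fract z" "y = of_nat CARD('a) ^ n * to_fract w"
    using assms by (elim padic_ballE)
  then have "x * y = of_nat CARD('a) ^ (m + n) * to_fract (z * w)"
    by (simp add: power_add)
  then show ?thesis by (metis padic_ball_memI)
qed

lemma padic_ball_antimono:
  assumes "x \<in> padic_ball n" "m \<le> n"
  shows "x \<in> padic_ball m"
proof -
  obtain z where "x = of_nat CARD('a) ^ n * to_fract z"
    using assms(1) by (rule padic_ballE)
  then have "x = of_nat CARD('a) ^ m * to_fract (of_nat CARD('a) ^ (n - m) * z)"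
    using assms(2)
    by (simp add: to_fract_power to_fract_of_nat flip: power_add mult.assoc)
  then show ?thesis by (metis padic_ball_memI)
qed

lemma padic_ball_of_nat_mult: "x \<in> padic_ball n \<Longrightarrow> of_nat k * x \<in> padic_ball n"
  using padic_ball_mult[of "of_nat k" 0 x n]
  by (simp add: padic_ball_0) (metis to_fract_of_nat rangeI)

section \<open>Overconvergent series and their derivations\<close>

lemma coeff3_simps [simp]:
  fixes F G :: "'a :: comm_ring_1 fps3"
  shows "coeff3 (0 :: 'a fps3) i j k = 0"
  "coeff3 (1 :: 'a fps3) i j k = (if i = 0 \<and> j = 0 \<and> k = 0 then 1 else 0)"
  "coeff3 (F + G) i j k = coeff3 F i j k + coeff3 G i j k"
  "coeff3 (const3 c) i j k = (if i = 0 \<and> j = 0 \<and> k = 0 then c else 0)"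
  "coeff3 (const3 c * F) i j k = c * coeff3 F i j k"
  "coeff3 (X3 :: 'a fps3) i j k = (if i = 1 \<and> j = 0 \<and> k = 0 then 1 else 0)"
  "coeff3 (Y3 :: 'a fps3) i j k = (if i = 0 \<and> j = 1 \<and> k = 0 then 1 else 0)"
  "coeff3 (Z3 :: 'a fps3) i j k = (if i = 0 \<and> j = 0 \<and> k = 1 then 1 else 0)"
  by (simp_all add: coeff3_def)

lemma coeff3_mult:
  "coeff3 (F * G) i j k =
     (\<Sum>a=0..i. \<Sum>b=0..j. \<Sum>c=0..k. coeff3 F a b c * coeff3 G (i - a) (j - b) (k - c))"
  by (simp add: coeff3_def fps_mult_nth fps_sum_nth)

lemma coeff3_of_nat_mult:
  "coeff3 (of_nat m * (F :: 'a :: comm_ring_1 fps3)) i j k = of_nat m * coeff3 F i j k"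
proof -
  have "(of_nat m :: 'a fps3) = const3 (of_nat m)"
    by (simp add: fps_of_nat)
  then show ?thesis by (simp only: coeff3_simps)
qed

section \<open>Derivations of nested power series\<close>

definition fps_map_coeffs :: "('a \<Rightarrow> 'b) \<Rightarrow> 'a fps \<Rightarrow> 'b fps" where
  "fps_map_coeffs D F = Abs_fps (\<lambda>i. D (fps_nth F i))"

definition derivation :: "('a :: comm_ring_1 \<Rightarrow> 'a) \<Rightarrow> bool" where
  "derivation D \<longleftrightarrow> (\<forall>x y. D (x + y) = D x + D y \<and> D (x * y) = x * D y + D x * y)"

lemma derivation_add: "derivation D \<Longrightarrow> D (x + y) = D x + D y"
  and derivation_mult: "derivation D \<Longrightarrow> D (x * y) = x * D y + D x * y"
  by (simp_all add: derivation_def)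

lemma derivation_zero: "derivation D \<Longrightarrow> D 0 = 0"
  by (metis add_cancel_right_right derivation_add)

lemma derivation_one: "derivation D \<Longrightarrow> D 1 = 0"
  using derivation_mult[of D 1 1] by simp

lemma derivation_minus: "derivation D \<Longrightarrow> D (- x) = - D x"
  by (metis add.right_inverse derivation_add derivation_zero eq_neg_iff_add_eq_0 add.commute)

lemma derivation_diff: "derivation D \<Longrightarrow> D (x - y) = D x - D y"
  by (simp only: diff_conv_add_uminus derivation_add derivation_minus)

lemma derivation_sum: "derivation D \<Longrightarrow> D (sum f A) = (\<Sum>i\<in>A. D (f i))"
  by (induction A rule: infinite_finite_induct) (simp_all add: derivation_zero derivation_add)

lemma derivation_power: "derivation D \<Longrightarrow> D (x ^ Suc n) = of_nat (Suc n) * x ^ n * D x"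
  by (induction n) (simp_all add: derivation_mult algebra_simps)

lemma derivation_fps_deriv: "derivation fps_deriv"
  by (simp add: derivation_def algebra_simps)

text \<open>Each coefficient of a product is a finite sum of products of coefficients, so the
  Leibniz rule passes through termwise. One and two applications to \<open>fps_deriv\<close> yield
  the partial derivatives in Y and Z.\<close>

lemma derivation_fps_map_coeffs:
  assumes "derivation D"
  shows "derivation (fps_map_coeffs D)"
  unfolding derivation_def fps_map_coeffs_def using assms
  by (auto simp: fps_eq_iff fps_mult_nth derivation_sum derivation_add derivation_mult
      sum.distrib)

lemma dY3_alt: "dY3 = fps_map_coeffs fps_deriv"
  by (simp add: fun_eq_iff dY3_def fps_map_coeffs_def)

lemma dZ3_alt: "dZ3 = fps_map_coeffs (fps_map_coeffs fps_deriv)"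
  by (simp add: fun_eq_iff dZ3_def fps_map_coeffs_def)

lemma derivation_d_series: "derivation (d_series Q)"
proof -
  have "derivation (dX3 :: 'a padic fps3 \<Rightarrow> _)"
    using derivation_fps_deriv by (simp add: dX3_def[abs_def])
  moreover have "derivation (dY3 :: 'a padic fps3 \<Rightarrow> _)" "derivation (dZ3 :: 'a padic fps3 \<Rightarrow> _)"
    unfolding dY3_alt dZ3_alt
    by (intro derivation_fps_map_coeffs derivation_fps_deriv)+
  ultimately show ?thesis
    by (simp add: derivation_def d_series_def algebra_simps)
qed

lemma coeff3_partial:
  "coeff3 (dX3 F) i j k = of_nat (Suc i) * coeff3 F (Suc i) j k"
  "coeff3 (dY3 F) i j k = of_nat (Suc j) * coeff3 F i (Suc j) k"
  "coeff3 (dZ3 F) i j k = of_nat (Suc k) * coeff3 F i j (Suc k)"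
proof -
  \<comment> \<open>The factor \<open>of_nat (Suc i)\<close> lives in an inner series ring.
    Rewriting the coefficient as one of a full \<open>fps3\<close> lets
    \<open>coeff3_of_nat_mult\<close> carry that factor down to the base field.\<close>
  have "coeff3 (dX3 F) i j k = coeff3 (of_nat (Suc i) * Abs_fps (\<lambda>_. fps_nth F (Suc i))) 0 j k"
    by (simp add: coeff3_def dX3_def)
  then show "coeff3 (dX3 F) i j k = of_nat (Suc i) * coeff3 F (Suc i) j k"
    by (simp only: coeff3_of_nat_mult) (simp add: coeff3_def)
  have "coeff3 (dY3 F) i j k
      = coeff3 (of_nat (Suc j) * Abs_fps (\<lambda>_. Abs_fps (\<lambda>_. fps_nth (fps_nth F i) (Suc j)))) 0 0 k"
    by (simp add: coeff3_def dY3_def fps_mult_nth_0)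
  then show "coeff3 (dY3 F) i j k = of_nat (Suc j) * coeff3 F i (Suc j) k"
    by (simp only: coeff3_of_nat_mult) (simp add: coeff3_def)
  show "coeff3 (dZ3 F) i j k = of_nat (Suc k) * coeff3 F i j (Suc k)"
    by (simp add: coeff3_def dZ3_def)
qed

section \<open>Overconvergent series: ring operations and partial derivatives\<close>

lemma dagger_intI:
  "(\<And>n i j k. C * n \<le> i + j + k \<Longrightarrow> coeff3 F i j k \<in> padic_ball n) \<Longrightarrow> F \<in> dagger_int"
  unfolding dagger_int_def by blast

lemma dagger_int_add:
  assumes "F \<in> dagger_int" "G \<in> dagger_int"
  shows "F + G \<in> dagger_int"
proof -
  obtain C D where C: "\<And>n i j k. C * n \<le> i + j + k \<Longrightarrow> coeff3 F i j k \<in> padic_ball n"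
    and D: "\<And>n i j k. D * n \<le> i + j + k \<Longrightarrow> coeff3 G i j k \<in> padic_ball n"
    using assms unfolding dagger_int_def by blast
  show ?thesis
  proof (rule dagger_intI[of "C + D"])
    fix n i j k assume "(C + D) * n \<le> i + j + k"
    then have "C * n \<le> i + j + k" "D * n \<le> i + j + k" by (simp_all add: distrib_right)
    then show "coeff3 (F + G) i j k \<in> padic_ball n"
      by (simp add: C D padic_ball_add)
  qed
qed

text \<open>Take the quotients of \<open>a\<close> and \<open>b\<close> by \<open>C\<close>.
  Rounding gives \<open>2 * n < n\<^sub>1 + n\<^sub>2 + 2\<close>, and the factor 2 absorbs this
  loss.\<close>

lemma split_degree:
  fixes C :: nat
  assumes "2 * C * n \<le> a + b"
  obtains n\<^sub>1 n\<^sub>2 where "C * n\<^sub>1 \<le> a" "C * n\<^sub>2 \<le> b" "n \<le> n\<^sub>1 + n\<^sub>2"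
proof (cases "C = 0")
  case True
  then show ?thesis using that[of n 0] by simp
next
  case False
  have "a < C * Suc (a div C)" "b < C * Suc (b div C)"
    using False by (simp_all add: dividend_less_times_div)
  then have "a + b < C * Suc (a div C) + C * Suc (b div C)" by (rule add_strict_mono)
  also have "\<dots> = C * (a div C + b div C + 2)" by (simp add: algebra_simps)
  finally have "C * (2 * n) < C * (a div C + b div C + 2)" using assms by (simp add: ac_simps)
  then have "n \<le> a div C + b div C" by (auto simp del: mult_Suc_right)
  then show ?thesis using that[of "a div C" "b div C"] by simp
qed

text \<open>In each term of the Cauchy product the two total degrees add up to
  \<open>i + j + k\<close>, so divisibility by p can be distributed over the two factors according
  to their degrees.\<close>

lemma dagger_int_mult:
  assumes "F \<in> dagger_int" "G \<in> dagger_int"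
  shows "F * G \<in> dagger_int"
proof -
  obtain C D where C: "\<And>n i j k. C * n \<le> i + j + k \<Longrightarrow> coeff3 F i j k \<in> padic_ball n"
    and D: "\<And>n i j k. D * n \<le> i + j + k \<Longrightarrow> coeff3 G i j k \<in> padic_ball n"
    using assms unfolding dagger_int_def by blast
  \<comment> \<open>\<open>C + D\<close> is a bound valid for both factors; the 2 is the one of
    \<open>split_degree\<close>.\<close>
  show ?thesis
  proof (rule dagger_intI[of "2 * (C + D)"])
    fix n i j k assume deg: "2 * (C + D) * n \<le> i + j + k"
    have "coeff3 F a b c * coeff3 G (i - a) (j - b) (k - c) \<in> padic_ball n"
      if "a \<le> i" "b \<le> j" "c \<le> k" for a b c
    proof -
      have "2 * (C + D) * n \<le> (a + b + c) + ((i - a) + (j - b) + (k - c))"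
        using deg that by simp
      then obtain n\<^sub>1 n\<^sub>2 where n: "(C + D) * n\<^sub>1 \<le> a + b + c"
          "(C + D) * n\<^sub>2 \<le> (i - a) + (j - b) + (k - c)" "n \<le> n\<^sub>1 + n\<^sub>2"
        by (rule split_degree)
      have "C * n\<^sub>1 \<le> a + b + c" "D * n\<^sub>2 \<le> (i - a) + (j - b) + (k - c)"
        using n(1,2) by (simp_all add: distrib_right)
      then have "coeff3 F a b c * coeff3 G (i - a) (j - b) (k - c) \<in> padic_ball (n\<^sub>1 + n\<^sub>2)"
        by (intro padic_ball_mult C D)
      then show ?thesis using n(3) by (rule padic_ball_antimono)
    qed
    then show "coeff3 (F * G) i j k \<in> padic_ball n"
      unfolding coeff3_mult by (intro padic_ball_sum) simp
  qed
qed

lemma dagger_int_const3: "const3 (to_fract z) \<in> dagger_int"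
  by (rule dagger_intI[of 1])
    (auto simp: padic_ball_0)

lemma dagger_int_dagger_rat: "F \<in> dagger_int \<Longrightarrow> F \<in> dagger_rat"
  unfolding dagger_rat_def by (auto intro!: exI[of _ 0])

lemma const3_mult: "const3 (a * b :: 'a :: comm_ring_1) = const3 a * const3 b"
  by simp

lemma dagger_int_prime_power:
  "(F :: 'p :: prime_card padic fps3) \<in> dagger_int \<Longrightarrow> const3 (of_nat CARD('p) ^ m) * F \<in> dagger_int"
  using dagger_int_mult[OF dagger_int_const3[of "of_nat CARD('p) ^ m"]]
  by (simp only: to_fract_power to_fract_of_nat)

lemma dagger_rat_add:
  fixes F G :: "'p :: prime_card padic fps3"
  assumes "F \<in> dagger_rat" "G \<in> dagger_rat"
  shows "F + G \<in> dagger_rat"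
proof -
  obtain m n where "const3 (of_nat CARD('p) ^ m) * F \<in> dagger_int"
      "const3 (of_nat CARD('p) ^ n) * G \<in> dagger_int"
    using assms unfolding dagger_rat_def by blast
  then have "const3 (of_nat CARD('p) ^ n) * (const3 (of_nat CARD('p) ^ m) * F)
      + const3 (of_nat CARD('p) ^ m) * (const3 (of_nat CARD('p) ^ n) * G) \<in> dagger_int"
    by (intro dagger_int_add dagger_int_prime_power[of "_ * _"])
  also have "const3 (of_nat CARD('p) ^ n) * (const3 (of_nat CARD('p) ^ m) * F)
      + const3 (of_nat CARD('p) ^ m) * (const3 (of_nat CARD('p) ^ n) * G)
      = const3 (of_nat CARD('p) ^ (m + n)) * (F + G)"
    by (simp only: power_add const3_mult distrib_left distrib_right mult_ac)
  finally show ?thesis unfolding dagger_rat_def by blast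
qed

lemma dagger_rat_mult:
  fixes F G :: "'p :: prime_card padic fps3"
  assumes "F \<in> dagger_rat" "G \<in> dagger_rat"
  shows "F * G \<in> dagger_rat"
proof -
  obtain m n where "const3 (of_nat CARD('p) ^ m) * F \<in> dagger_int"
      "const3 (of_nat CARD('p) ^ n) * G \<in> dagger_int"
    using assms unfolding dagger_rat_def by blast
  then have "(const3 (of_nat CARD('p) ^ m) * F) * (const3 (of_nat CARD('p) ^ n) * G) \<in> dagger_int"
    by (rule dagger_int_mult)
  also have "(const3 (of_nat CARD('p) ^ m) * F) * (const3 (of_nat CARD('p) ^ n) * G)
      = const3 (of_nat CARD('p) ^ (m + n)) * (F * G)"
    by (simp only: power_add const3_mult mult_ac)
  finally show ?thesis unfolding dagger_rat_def by blast
qed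

text \<open>A power of p clears the denominator of any constant, by
  \<open>padic_eq_fraction\<close>.\<close>

lemma dagger_rat_const3: "const3 c \<in> dagger_rat"
proof -
  obtain m z where "of_nat CARD('a) ^ m * c = to_fract z" by (rule padic_eq_fraction)
  then have "const3 (of_nat CARD('a) ^ m) * const3 c \<in> dagger_int"
    by (simp only: const3_mult[symmetric] dagger_int_const3)
  then show ?thesis unfolding dagger_rat_def by blast
qed

lemma dagger_rat_generators: "X3 \<in> dagger_rat" "Y3 \<in> dagger_rat" "Z3 \<in> dagger_rat"
proof -
  \<comment> \<open>With the constant 2, a term of degree 1 is constrained only for
    \<open>n = 0\<close>, that is, to be integral; with the constant 1 it would have to be divisible
    by p.\<close>
  have "1 \<in> padic_ball n" if "2 * n \<le> Suc 0" for n
    using that range_eqI[of 1 to_fract 1] by (cases n) (simp_all add: padic_ball_0)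
  then show "X3 \<in> dagger_rat" "Y3 \<in> dagger_rat" "Z3 \<in> dagger_rat"
    by (intro dagger_int_dagger_rat dagger_intI[of 2]; force)+
qed

lemma dagger_rat_0: "0 \<in> dagger_rat" and dagger_rat_1: "1 \<in> dagger_rat"
  using dagger_rat_const3[of 0] dagger_rat_const3[of 1] by simp_all

lemma dagger_rat_uminus: "F \<in> dagger_rat \<Longrightarrow> - F \<in> dagger_rat"
  using dagger_rat_mult[OF dagger_rat_const3[of "-1"], of F]
  by (simp flip: fps_const_neg)

lemma dagger_rat_diff: "F \<in> dagger_rat \<Longrightarrow> G \<in> dagger_rat \<Longrightarrow> F - G \<in> dagger_rat"
  using dagger_rat_add[OF _ dagger_rat_uminus, of F G] by simp

lemma dagger_rat_power: "F \<in> dagger_rat \<Longrightarrow> F ^ n \<in> dagger_rat"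
  by (induction n) (simp_all add: dagger_rat_1 dagger_rat_mult)

lemma dagger_rat_sum: "(\<And>i. i \<in> A \<Longrightarrow> f i \<in> dagger_rat) \<Longrightarrow> sum f A \<in> dagger_rat"
  by (induction A rule: infinite_finite_induct) (simp_all add: dagger_rat_0 dagger_rat_add)

lemma dagger_rat_poly3: "poly3 f \<in> dagger_rat"
  unfolding poly3_def
  by (intro dagger_rat_sum dagger_rat_mult dagger_rat_const3 dagger_rat_power dagger_rat_generators)

lemma dagger_rat_numeral: "numeral n \<in> dagger_rat"
  using dagger_rat_const3[of "numeral n"] by (simp add: numeral_fps_const)

text \<open>A coefficient of a partial derivative is an integer multiple of a coefficient of
  \<open>F\<close> one degree higher, so the same constants \<open>m\<close> and \<open>C\<close>
  work.\<close>

lemma dagger_rat_partial: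
  assumes "F \<in> dagger_rat"
  shows "dX3 F \<in> dagger_rat" "dY3 F \<in> dagger_rat" "dZ3 F \<in> dagger_rat"
proof -
  obtain m C where C: "\<And>n i j k. C * n \<le> i + j + k \<Longrightarrow>
      of_nat CARD('a) ^ m * coeff3 F i j k \<in> padic_ball n"
    using assms unfolding dagger_rat_def dagger_int_def by auto
  have *: "of_nat CARD('a) ^ m * (of_nat l * coeff3 F i j k) \<in> padic_ball n"
    if "C * n \<le> i + j + k" for l n i j k
    using padic_ball_of_nat_mult[OF C[OF that], of l] by (simp only: mult_ac)
  have "const3 (of_nat CARD('a) ^ m) * dX3 F \<in> dagger_int"
       "const3 (of_nat CARD('a) ^ m) * dY3 F \<in> dagger_int"
       "const3 (of_nat CARD('a) ^ m) * dZ3 F \<in> dagger_int"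
    by (rule dagger_intI[of C], simp only: coeff3_simps coeff3_partial, rule *, simp)+
  then show "dX3 F \<in> dagger_rat" "dY3 F \<in> dagger_rat" "dZ3 F \<in> dagger_rat"
    unfolding dagger_rat_def by blast+
qed

lemma dagger_rat_d_series: "F \<in> dagger_rat \<Longrightarrow> d_series Q F \<in> dagger_rat"
  unfolding d_series_def
  by (intro dagger_rat_diff dagger_rat_add dagger_rat_mult dagger_rat_power dagger_rat_partial
      dagger_rat_poly3 dagger_rat_generators dagger_rat_numeral)

section \<open>The curve and its differentials\<close>

lemma fps_nth_poly3: "fps_nth (poly3 f) i = fps_const (fps_const (coeff f i))"
  by (simp add: poly3_def fps_sum_nth fps_X_power_nth coeff_eq_0 not_le if_distrib[of "\<lambda>x. _ * x"] cong: if_cong)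

lemma poly3_add: "poly3 (f + h) = poly3 f + poly3 h"
  by (simp add: fps_eq_iff fps_nth_poly3)

lemma poly3_diff: "poly3 (f - h) = poly3 f - poly3 h"
  by (simp add: fps_eq_iff fps_nth_poly3)

lemma fps_const_sum: "fps_const (sum f A) = (\<Sum>i\<in>A. fps_const (f i))"
  by (induction A rule: infinite_finite_induct) (simp_all flip: fps_const_add)

lemma poly3_mult: "poly3 (f * h) = poly3 f * poly3 h"
proof (rule fps_ext)
  fix n
  have "fps_nth (poly3 (f * h)) n = (\<Sum>i\<le>n. fps_nth (poly3 f) i * fps_nth (poly3 h) (n - i))"
    by (simp add: fps_nth_poly3 coeff_mult fps_const_sum)
  then show "fps_nth (poly3 (f * h)) n = fps_nth (poly3 f * poly3 h) n"
    by (simp add: fps_mult_nth atLeast0AtMost)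
qed

lemma poly3_const: "poly3 [:c:] = const3 c"
  by (simp add: poly3_def)

lemma poly3_0 [simp]: "poly3 0 = 0"
  by (simp add: poly3_def)

lemma poly3_sum: "poly3 (sum f A) = (\<Sum>i\<in>A. poly3 (f i))"
  by (induction A rule: infinite_finite_induct) (simp_all add: poly3_add)

lemma poly3_monom: "poly3 (monom c n) = const3 c * X3 ^ n"
  by (rule fps_ext) (simp add: fps_nth_poly3 fps_X_power_nth)

lemma of_nat_fps: "(of_nat m :: 'a :: comm_ring_1 fps fps) = fps_const (fps_const (of_nat m))"
  by (simp add: fps_of_nat)

text \<open>As simp rules these would merge monomials in \<^term>\<open>Y3\<close> and \<^term>\<open>Z3\<close> into a single \<^const>\<open>fps_const\<close>.\<close>

declare fps_const_mult [simp del] fps_const_power [simp del] fps_const_add [simp del]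
  fps_const_sub [simp del] fps_const_neg [simp del]

section \<open>The quotient by the curve ideal\<close>

lemma cring_dagger_ring: "cring (dagger_ring :: 'p :: prime_card padic fps3 ring)"
proof (intro cringI abelian_groupI comm_monoidI)
  show "\<exists>y\<in>carrier dagger_ring. y \<oplus>\<^bsub>dagger_ring\<^esub> x = \<zero>\<^bsub>dagger_ring\<^esub>"
    if "x \<in> carrier dagger_ring" for x :: "'p padic fps3"
    using that dagger_rat_uminus[of x] by (intro bexI[of _ "- x"]) (simp_all add: dagger_ring_def)
qed (auto simp: dagger_ring_def dagger_rat_add dagger_rat_mult dagger_rat_0 dagger_rat_1
      algebra_simps)

lemmas ring_dagger_ring = cring.axioms(1)[OF cring_dagger_ring]

lemma dagger_ring_simps [simp]:
  "carrier dagger_ring = dagger_rat" "a \<oplus>\<^bsub>dagger_ring\<^esub> b = a + b"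
  "a \<otimes>\<^bsub>dagger_ring\<^esub> b = a * b" "\<one>\<^bsub>dagger_ring\<^esub> = 1" "\<zero>\<^bsub>dagger_ring\<^esub> = 0"
  by (simp_all add: dagger_ring_def)

lemma dagger_ring_a_inv:
  assumes "a \<in> dagger_rat"
  shows "\<ominus>\<^bsub>dagger_ring\<^esub> a = - a"
proof -
  interpret cring "dagger_ring :: 'a padic fps3 ring" by (rule cring_dagger_ring)
  show ?thesis using assms by (intro minus_equality) (simp_all add: dagger_rat_uminus)
qed

lemma dagger_ring_a_minus:
  "b \<in> dagger_rat \<Longrightarrow> a \<ominus>\<^bsub>dagger_ring\<^esub> b = a - b"
  by (simp add: a_minus_def dagger_ring_a_inv)

lemma ideal_curve_ideal: "ideal (curve_ideal Q) dagger_ring"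
  unfolding curve_ideal_def
  by (intro ring.genideal_ideal ring_dagger_ring)
    (simp add: dagger_rat_diff dagger_rat_mult dagger_rat_power dagger_rat_generators
      dagger_rat_poly3 dagger_rat_1)

lemma curve_ideal_0: "0 \<in> curve_ideal Q"
    and curve_ideal_add: "a \<in> curve_ideal Q \<Longrightarrow> b \<in> curve_ideal Q \<Longrightarrow> a + b \<in> curve_ideal Q"
    and curve_ideal_mult: "c \<in> dagger_rat \<Longrightarrow> a \<in> curve_ideal Q \<Longrightarrow> c * a \<in> curve_ideal Q"
    and curve_ideal_dagger_rat: "a \<in> curve_ideal Q \<Longrightarrow> a \<in> dagger_rat"
proof -
  interpret ideal "curve_ideal Q" dagger_ring by (rule ideal_curve_ideal)
  show "0 \<in> curve_ideal Q" using additive_subgroup.zero_closed[OF is_additive_subgroup] by simp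
  show "a \<in> curve_ideal Q \<Longrightarrow> b \<in> curve_ideal Q \<Longrightarrow> a + b \<in> curve_ideal Q"
    using additive_subgroup.a_closed[OF is_additive_subgroup, of a b] by simp
  show "c \<in> dagger_rat \<Longrightarrow> a \<in> curve_ideal Q \<Longrightarrow> c * a \<in> curve_ideal Q"
    using I_l_closed[of a c] by simp
  show "a \<in> curve_ideal Q \<Longrightarrow> a \<in> dagger_rat" using Icarr by simp
qed

lemma curve_ideal_uminus: "a \<in> curve_ideal Q \<Longrightarrow> - a \<in> curve_ideal Q"
  using curve_ideal_mult[OF dagger_rat_uminus[OF dagger_rat_1], of a Q] by simp

lemma curve_ideal_diff:
  "a \<in> curve_ideal Q \<Longrightarrow> b \<in> curve_ideal Q \<Longrightarrow> a - b \<in> curve_ideal Q"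
  using curve_ideal_add[OF _ curve_ideal_uminus, of a Q b] by simp

lemma curve_ideal_relations:
  "Y3 ^ 2 - poly3 (ratpoly Q) \<in> curve_ideal Q" "Y3 * Z3 - 1 \<in> curve_ideal Q"
proof -
  have "{Y3 ^ 2 - poly3 (ratpoly Q), Y3 * Z3 - 1} \<subseteq> curve_ideal Q"
    unfolding curve_ideal_def
    by (intro ring.genideal_self ring_dagger_ring)
      (simp add: dagger_rat_diff dagger_rat_mult dagger_rat_power dagger_rat_generators
        dagger_rat_poly3 dagger_rat_1)
  then show "Y3 ^ 2 - poly3 (ratpoly Q) \<in> curve_ideal Q" "Y3 * Z3 - 1 \<in> curve_ideal Q" by auto
qed

lemma ring_hom_dagger_class: "ring_hom_ring dagger_ring (dagger_algebra Q) (dagger_class Q)"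
  unfolding dagger_algebra_def dagger_class_def[abs_def]
  by (rule ideal.rcos_ring_hom_ring[OF ideal_curve_ideal])

lemma dagger_class_in_carrier:
  "F \<in> dagger_rat \<Longrightarrow> dagger_class Q F \<in> carrier (dagger_algebra Q)"
  using ring_hom_ring.homh[OF ring_hom_dagger_class, of Q] ring_hom_closed by fastforce

lemma dagger_class_a_minus:
  assumes "F \<in> dagger_rat" "G \<in> dagger_rat"
  shows "dagger_class Q F \<ominus>\<^bsub>dagger_algebra Q\<^esub> dagger_class Q G = dagger_class Q (F - G)"
proof -
  interpret ring_hom_ring dagger_ring "dagger_algebra Q" "dagger_class Q"
    by (rule ring_hom_dagger_class)
  show ?thesis
    using hom_add[of F "\<ominus>\<^bsub>dagger_ring\<^esub> G"] hom_a_inv[of G] assms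
    by (simp add: a_minus_def dagger_ring_a_inv dagger_rat_uminus)
qed

lemma dagger_class_eq_iff:
  assumes "F \<in> dagger_rat" "G \<in> dagger_rat"
  shows "dagger_class Q F = dagger_class Q G \<longleftrightarrow> F - G \<in> curve_ideal Q"
  using ring.quotient_eq_iff_same_a_r_cos[OF ring_dagger_ring ideal_curve_ideal, of F G Q] assms
  by (simp add: dagger_class_def dagger_ring_a_minus)

lemma mem_dagger_class_iff:
  assumes "F \<in> dagger_rat"
  shows "G \<in> dagger_class Q F \<longleftrightarrow> G - F \<in> curve_ideal Q"
proof
  assume "G \<in> dagger_class Q F"
  then show "G - F \<in> curve_ideal Q"
    by (auto simp: dagger_class_def a_r_coset_def')
next
  assume "G - F \<in> curve_ideal Q"
  then show "G \<in> dagger_class Q F"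
    by (auto simp: dagger_class_def a_r_coset_def' intro!: bexI[of _ "G - F"])
qed

section \<open>The differential and its descent to the quotient\<close>

lemma ratpoly_pderiv: "ratpoly (pderiv Q) = pderiv (ratpoly Q)"
  by (rule poly_eqI) (simp add: coeff_map_poly coeff_pderiv to_fract_of_nat flip: of_nat_Suc)

lemma d_series_poly3: "d_series Q (poly3 f) = 2 * Y3 * poly3 (pderiv f)"
proof -
  have "dX3 (poly3 f) = poly3 (pderiv f)"
    by (rule fps_ext)
      (simp add: dX3_def fps_nth_poly3 coeff_pderiv of_nat_fps fps_const_mult flip: of_nat_Suc)
  moreover have "dY3 (poly3 f) = 0"
    by (rule fps_ext) (simp add: dY3_def fps_nth_poly3)
  moreover have "dZ3 (poly3 f) = 0"
    by (rule fps_ext, rule fps_ext) (simp add: dZ3_def fps_nth_poly3)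
  ultimately show ?thesis by (simp add: d_series_def)
qed

lemma d_series_Y3: "d_series Q Y3 = poly3 (pderiv (ratpoly Q))"
proof -
  have "dX3 Y3 = (0 :: 'a padic fps3)"
    by (simp add: dX3_def)
  moreover have "dY3 Y3 = (1 :: 'a padic fps3)"
    by (rule fps_ext) (simp add: dY3_def)
  moreover have "dZ3 Y3 = (0 :: 'a padic fps3)"
    by (rule fps_ext, rule fps_ext) (simp add: dZ3_def)
  ultimately show ?thesis by (simp add: d_series_def ratpoly_pderiv)
qed

lemma d_series_Z3: "d_series Q Z3 = - (Z3 ^ 2 * poly3 (pderiv (ratpoly Q)))"
proof -
  have "dX3 Z3 = (0 :: 'a padic fps3)"
    by (simp add: dX3_def)
  moreover have "dY3 Z3 = (0 :: 'a padic fps3)"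
    by (rule fps_ext) (simp add: dY3_def)
  moreover have "dZ3 Z3 = (1 :: 'a padic fps3)"
    by (rule fps_ext, rule fps_ext) (simp add: dZ3_def)
  ultimately show ?thesis by (simp add: d_series_def ratpoly_pderiv)
qed

text \<open>It suffices to look at the two generators, since by the Leibniz rule the elements of the ideal
  whose derivative also lies in the ideal form an ideal.\<close>

lemma d_series_curve_ideal:
  assumes "F \<in> curve_ideal Q"
  shows "d_series Q F \<in> curve_ideal Q"
proof -
  let ?J = "{F \<in> curve_ideal Q. d_series Q F \<in> curve_ideal Q}"
  note D = derivation_d_series[of Q]
  have mult: "a * x \<in> ?J" if "x \<in> ?J" "a \<in> dagger_rat" for a x
    using that by (simp add: derivation_mult[OF D] curve_ideal_add curve_ideal_mult
        dagger_rat_d_series)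
  have "ideal ?J dagger_ring"
  proof (rule idealI[OF ring_dagger_ring])
    interpret ring "dagger_ring :: 'a padic fps3 ring" by (rule ring_dagger_ring)
    show "subgroup ?J (add_monoid dagger_ring)"
    proof (rule add.subgroupI)
      show "\<ominus>\<^bsub>dagger_ring\<^esub> a \<in> ?J" if "a \<in> ?J" for a
      proof -
        have "a \<in> dagger_rat" using that curve_ideal_dagger_rat[of a Q] by simp
        then show ?thesis
          using that by (simp add: dagger_ring_a_inv curve_ideal_uminus derivation_minus[OF D])
      qed
      show "a \<oplus>\<^bsub>dagger_ring\<^esub> b \<in> ?J" if "a \<in> ?J" "b \<in> ?J" for a b
        using that by (simp add: curve_ideal_add derivation_add[OF D])
    qed (use curve_ideal_0[of Q] curve_ideal_dagger_rat[of _ Q] in \<open>auto simp: derivation_zero[OF D]\<close>)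
  next
    fix a x assume "a \<in> ?J" "x \<in> carrier (dagger_ring :: 'a padic fps3 ring)"
    then show "x \<otimes>\<^bsub>dagger_ring\<^esub> a \<in> ?J" "a \<otimes>\<^bsub>dagger_ring\<^esub> x \<in> ?J"
      using mult[of a x] by (simp_all add: mult.commute)
  qed
  moreover have "Y3 ^ 2 - poly3 (ratpoly Q) \<in> ?J"
  proof -
    \<comment> \<open>The terms \<open>2 * Y * Q'\<close> coming from \<open>Y ^ 2\<close> and from
      \<open>Q\<close> cancel exactly.\<close>
    have "d_series Q (Y3 ^ 2 - poly3 (ratpoly Q)) = 0"
      by (simp add: derivation_diff[OF D] derivation_mult[OF D] power2_eq_square d_series_poly3
          d_series_Y3 algebra_simps)
    then show ?thesis using curve_ideal_relations(1)[of Q] curve_ideal_0[of Q] by simp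
  qed
  moreover have "Y3 * Z3 - 1 \<in> ?J"
  proof -
    \<comment> \<open>Here the derivative \<open>Q' * Z - Y * Z ^ 2 * Q'\<close> is not zero, but it
      is a multiple of the generator itself.\<close>
    have "d_series Q (Y3 * Z3 - 1) = - (poly3 (pderiv (ratpoly Q)) * Z3) * (Y3 * Z3 - 1)"
      by (simp add: derivation_diff[OF D] derivation_mult[OF D] derivation_one[OF D]
          power2_eq_square d_series_Y3 d_series_Z3 algebra_simps)
    moreover have "- (poly3 (pderiv (ratpoly Q)) * Z3) * (Y3 * Z3 - 1) \<in> curve_ideal Q"
      by (intro curve_ideal_mult curve_ideal_relations dagger_rat_uminus dagger_rat_mult
          dagger_rat_poly3 dagger_rat_generators)
    ultimately show ?thesis using curve_ideal_relations(2)[of Q] by simp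
  qed
  ultimately have "curve_ideal Q \<subseteq> ?J"
    unfolding curve_ideal_def by (intro ring.genideal_minimal[OF ring_dagger_ring]) simp_all
  then show ?thesis using assms by blast
qed

text \<open>\<open>d_dagger\<close> takes the only element of an image over a coset. Two
  representatives differ by an element of the ideal, and so do their derivatives, hence the image is
  a singleton.\<close>

lemma d_dagger_class:
  assumes "F \<in> dagger_rat"
  shows "d_dagger Q (dagger_class Q F) = dagger_class Q (d_series Q F)"
proof -
  have "dagger_class Q (d_series Q G) = dagger_class Q (d_series Q F)"
    if "G \<in> dagger_class Q F" for G
  proof -
    have GF: "G - F \<in> curve_ideal Q" using that assms by (simp add: mem_dagger_class_iff)
    then have "G \<in> dagger_rat"
      using dagger_rat_add[OF curve_ideal_dagger_rat assms, of "G - F" Q] by simp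
    moreover have "d_series Q G - d_series Q F \<in> curve_ideal Q"
      using d_series_curve_ideal[OF GF] by (simp add: derivation_diff[OF derivation_d_series])
    ultimately show ?thesis using assms by (simp add: dagger_class_eq_iff dagger_rat_d_series)
  qed
  moreover have "F \<in> dagger_class Q F"
    using assms by (simp add: mem_dagger_class_iff curve_ideal_0)
  ultimately have "(\<lambda>G. dagger_class Q (d_series Q G)) ` dagger_class Q F
      = {dagger_class Q (d_series Q F)}"
    by blast
  then show ?thesis by (simp add: d_dagger_def)
qed

text \<open>A representative of \<open>y\<^sup>1\<^sup>-\<^sup>2\<^sup>t\<close>; for \<open>t = 0\<close> this is \<open>y\<close>, not a power of \<open>y\<^sup>-\<^sup>1\<close>.\<close>

definition odd_power :: "nat \<Rightarrow> 'p :: prime_card padic fps3" where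
  "odd_power t = (if t = 0 then Y3 else Z3 ^ (2 * t - 1))"

lemma dagger_rat_odd_power: "odd_power t \<in> dagger_rat"
  by (simp add: odd_power_def dagger_rat_generators dagger_rat_power)

text \<open>This is \<open>d(y^(1-2t)) = -(2t-1) y^(-2t) dy\<close> with \<open>dy\<close> read as
  \<open>Q'\<close>. The factor is an integer, so that \<open>t = 0\<close> gives \<open>dy\<close>
  by the same formula.\<close>

lemma d_series_odd_power:
  "d_series Q (odd_power t) = - (of_int (2 * int t - 1) * Z3 ^ (2 * t) * poly3 (pderiv (ratpoly Q)))"
proof (cases t)
  case 0
  then show ?thesis by (simp add: odd_power_def d_series_Y3)
next
  case (Suc m)
  have "odd_power t = Z3 ^ Suc (2 * m)" using Suc by (simp add: odd_power_def)
  then have "d_series Q (odd_power t) = of_nat (Suc (2 * m)) * Z3 ^ (2 * m) * d_series Q Z3"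
    by (metis derivation_power[OF derivation_d_series])
  then show ?thesis
    by (simp add: Suc d_series_Z3 power2_eq_square algebra_simps)
qed

section \<open>Congruences modulo the curve ideal\<close>

definition curve_cong where "curve_cong Q a b \<longleftrightarrow> a - b \<in> curve_ideal Q"

lemma curve_cong_refl: "curve_cong Q a a"
  by (simp add: curve_cong_def curve_ideal_0)

lemma curve_cong_sym: "curve_cong Q a b \<Longrightarrow> curve_cong Q b a"
  unfolding curve_cong_def using curve_ideal_uminus[of "a - b"] by simp

lemma curve_cong_trans [trans]: "curve_cong Q a b \<Longrightarrow> curve_cong Q b c \<Longrightarrow> curve_cong Q a c"
  unfolding curve_cong_def using curve_ideal_add[of "a - b" Q "b - c"] by simp

lemma curve_cong_add:
  "curve_cong Q a b \<Longrightarrow> curve_cong Q c d \<Longrightarrow> curve_cong Q (a + c) (b + d)"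
  unfolding curve_cong_def using curve_ideal_add[of "a - b" Q "c - d"] by (simp add: algebra_simps)

lemma curve_cong_mult:
  "c \<in> dagger_rat \<Longrightarrow> curve_cong Q a b \<Longrightarrow> curve_cong Q (c * a) (c * b)"
  unfolding curve_cong_def using curve_ideal_mult[of c "a - b" Q] by (simp add: algebra_simps)

text \<open>The identity \<open>Q * y^(-2) = 1\<close>, obtained by combining both
  generators.\<close>

lemma poly3_Z3_cong:
  "curve_cong Q (poly3 (ratpoly Q) * Z3 ^ (2 * t + 2)) (Z3 ^ (2 * t))"
proof -
  have "Z3 ^ (2 * t + 2) * (Y3 ^ 2 - poly3 (ratpoly Q)) \<in> curve_ideal Q"
    by (intro curve_ideal_mult curve_ideal_relations dagger_rat_power dagger_rat_generators)
  \<comment> \<open>The product of the last two factors is \<open>Y ^ 2 * Z ^ 2 - 1\<close>;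
    subtracting the previous multiple of \<open>Y ^ 2 - Q\<close> eliminates Y.\<close>
  moreover have "Z3 ^ (2 * t) * (Y3 * Z3 + 1) * (Y3 * Z3 - 1) \<in> curve_ideal Q"
    by (intro curve_ideal_mult curve_ideal_relations dagger_rat_power dagger_rat_generators
        dagger_rat_mult dagger_rat_add dagger_rat_1)
  ultimately have "Z3 ^ (2 * t) * (Y3 * Z3 + 1) * (Y3 * Z3 - 1)
      - Z3 ^ (2 * t + 2) * (Y3 ^ 2 - poly3 (ratpoly Q)) \<in> curve_ideal Q"
    by (intro curve_ideal_diff)
  then show ?thesis
    by (simp add: curve_cong_def power_add power2_eq_square algebra_simps)
qed

lemma Y3_odd_power_cong:
  "curve_cong Q (Y3 * odd_power t) (poly3 (ratpoly Q) * Z3 ^ (2 * t))"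
proof (cases t)
  case 0
  then show ?thesis
    using curve_ideal_relations(1)[of Q] by (simp add: curve_cong_def odd_power_def power2_eq_square)
next
  case (Suc m)
  have "Z3 ^ (2 * m) * (Y3 * Z3 - 1) \<in> curve_ideal Q"
    by (intro curve_ideal_mult curve_ideal_relations dagger_rat_power dagger_rat_generators)
  then have "curve_cong Q (Y3 * odd_power t) (Z3 ^ (2 * m))"
    by (simp add: curve_cong_def odd_power_def Suc algebra_simps)
  also have "curve_cong Q (Z3 ^ (2 * m)) (poly3 (ratpoly Q) * Z3 ^ (2 * t))"
    using curve_cong_sym[OF poly3_Z3_cong[of Q m]] Suc by simp
  finally show ?thesis .
qed

lemma of_int_poly3: "of_int m * poly3 f = poly3 (of_int m * f)"
proof -
  have "(of_int m :: 'a fps3) = const3 (of_int m)" by (simp add: fps_of_int)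
  moreover have "of_int m * f = [:of_int m:] * f" by (simp add: of_int_poly)
  ultimately show ?thesis by (simp only: poly3_mult poly3_const)
qed

text \<open>By Leibniz, the derivative of \<open>f\<close> contributes
  \<open>2 f' y * y^(1-2t)\<close>. Only this term has to be rewritten modulo the ideal, as
  \<open>2 f' Q y^(-2t)\<close>, which gives both terms the common factor
  \<open>y^(-2t)\<close>.\<close>

lemma d_series_poly3_odd_power:
  "curve_cong Q (d_series Q (poly3 f * odd_power t))
     (poly3 (2 * pderiv f * ratpoly Q - of_int (2 * int t - 1) * f * pderiv (ratpoly Q)) * Z3 ^ (2 * t))"
proof -
  let ?c = "of_int (2 * int t - 1)"
  have "d_series Q (poly3 f * odd_power t)
      = 2 * poly3 (pderiv f) * (Y3 * odd_power t)
        + - (?c * poly3 f * poly3 (pderiv (ratpoly Q))) * Z3 ^ (2 * t)"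
    by (simp add: derivation_mult[OF derivation_d_series] d_series_poly3 d_series_odd_power
        algebra_simps)
  also have "curve_cong Q \<dots> (2 * poly3 (pderiv f) * (poly3 (ratpoly Q) * Z3 ^ (2 * t))
        + - (?c * poly3 f * poly3 (pderiv (ratpoly Q))) * Z3 ^ (2 * t))"
    by (intro curve_cong_add curve_cong_refl curve_cong_mult Y3_odd_power_cong dagger_rat_mult
        dagger_rat_numeral dagger_rat_poly3)
  also have "2 * poly3 (pderiv f) * (poly3 (ratpoly Q) * Z3 ^ (2 * t))
        + - (?c * poly3 f * poly3 (pderiv (ratpoly Q))) * Z3 ^ (2 * t)
      = (of_int 2 * poly3 (pderiv f * ratpoly Q)
        - ?c * poly3 (f * pderiv (ratpoly Q))) * Z3 ^ (2 * t)"
    by (simp add: poly3_mult algebra_simps)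
  also have "\<dots> = poly3 (2 * pderiv f * ratpoly Q - ?c * f * pderiv (ratpoly Q)) * Z3 ^ (2 * t)"
  proof -
    have "2 * pderiv f * ratpoly Q = of_int 2 * (pderiv f * ratpoly Q)" by simp
    then show ?thesis by (simp only: of_int_poly3 poly3_diff mult.assoc)
  qed
  finally show ?thesis .
qed

section \<open>Exact differences and values at points\<close>

lemma coeff3_poly3_monomial:
  "coeff3 (poly3 f * (Y3 ^ a * Z3 ^ b)) i j k = (if j = a \<and> k = b then coeff f i else 0)"
proof -
  have eq: "(Y3 ^ a * Z3 ^ b :: 'a fps3) = fps_const (fps_X ^ a * fps_const (fps_X ^ b))"
    by (simp add: fps_const_power fps_const_mult)
  show ?thesis
    unfolding eq by (simp add: coeff3_def fps_nth_poly3 fps_X_power_nth)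
qed

text \<open>\<open>B\<close> may be any finite set containing the support, which lets two series be
  summed over a common index set.\<close>

definition finite_value :: "'a :: comm_ring_1 fps3 \<Rightarrow> 'a \<Rightarrow> 'a \<Rightarrow> 'a \<Rightarrow> 'a \<Rightarrow> bool" where
  "finite_value F x y z e \<longleftrightarrow> (\<exists>B. finite B \<and> (\<forall>i j k. (i, j, k) \<notin> B \<longrightarrow> coeff3 F i j k = 0)
     \<and> e = (\<Sum>(i, j, k)\<in>B. coeff3 F i j k * x ^ i * y ^ j * z ^ k))"

lemma finite_value_sum_superset:
  fixes F :: "'a :: comm_ring_1 fps3"
  assumes "finite B'" "B \<subseteq> B'" "\<forall>i j k. (i, j, k) \<notin> B \<longrightarrow> coeff3 F i j k = 0"
  shows "(\<Sum>(i, j, k)\<in>B'. coeff3 F i j k * x ^ i * y ^ j * z ^ k)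
    = (\<Sum>(i, j, k)\<in>B. coeff3 F i j k * x ^ i * y ^ j * z ^ k)"
  using assms by (intro sum.mono_neutral_right) auto

lemma finite_value_0: "finite_value 0 x y z 0"
  unfolding finite_value_def by (intro exI[of _ "{}"]) simp

lemma finite_value_add:
  assumes "finite_value F x y z a" "finite_value G x y z b"
  shows "finite_value (F + G) x y z (a + b)"
proof -
  let ?t = "\<lambda>H (i, j, k). coeff3 H i j k * x ^ i * y ^ j * z ^ k"
  obtain A B where A: "finite A" "\<forall>i j k. (i, j, k) \<notin> A \<longrightarrow> coeff3 F i j k = 0" "a = sum (?t F) A"
    and B: "finite B" "\<forall>i j k. (i, j, k) \<notin> B \<longrightarrow> coeff3 G i j k = 0" "b = sum (?t G) B"
    using assms unfolding finite_value_def by blast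
  have "a = sum (?t F) (A \<union> B)" "b = sum (?t G) (A \<union> B)"
    unfolding A(3) B(3) using A(1,2) B(1,2) by (intro finite_value_sum_superset[symmetric]; simp)+
  then have "a + b = sum (?t (F + G)) (A \<union> B)"
    by (simp add: sum.distrib[symmetric] case_prod_unfold distrib_right)
  then show ?thesis
    unfolding finite_value_def using A(1,2) B(1,2) by (intro exI[of _ "A \<union> B"]) simp
qed

lemma finite_value_poly3_monomial:
  "finite_value (poly3 f * (Y3 ^ a * Z3 ^ b)) x y z (poly f x * y ^ a * z ^ b)"
proof -
  let ?B = "(\<lambda>i. (i, a, b)) ` {..degree f}"
  have "(\<Sum>(i, j, k)\<in>?B. coeff3 (poly3 f * (Y3 ^ a * Z3 ^ b)) i j k * x ^ i * y ^ j * z ^ k)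
      = (\<Sum>i\<le>degree f. coeff f i * x ^ i * y ^ a * z ^ b)"
    by (subst sum.reindex) (auto simp: inj_on_def coeff3_poly3_monomial)
  also have "\<dots> = poly f x * y ^ a * z ^ b"
    by (simp add: poly_altdef sum_distrib_right)
  finally show ?thesis
    unfolding finite_value_def
    by (intro exI[of _ ?B]) (auto simp: coeff3_poly3_monomial image_iff not_le intro!: coeff_eq_0)
qed

text \<open>Almost all terms vanish, so convergence holds for every choice of radii and the partial
  sums are eventually equal to \<open>e\<close>.\<close>

lemma dagger_value_finite:
  assumes "F \<in> G" "finite_value F x y (1 / y) e"
  shows "dagger_value G (x, y) e"
proof -
  obtain B where B: "finite B" "\<And>i j k. (i, j, k) \<notin> B \<Longrightarrow> coeff3 F i j k = 0"
    and e: "e = (\<Sum>(i, j, k)\<in>B. coeff3 F i j k * x ^ i * y ^ j * (1 / y) ^ k)"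
    using assms(2) unfolding finite_value_def by blast
  have "finite {(i, j, k). coeff3 F i j k * u ^ i * v ^ j * w ^ k \<notin> padic_ball n}" for u v w n
    by (rule finite_subset[OF _ B(1)]) (use B(2) in force)
  moreover have "\<forall>\<^sub>F B' in finite_sets_at_top.
      (\<Sum>(i, j, k)\<in>B'. coeff3 F i j k * x ^ i * y ^ j * (1 / y) ^ k) - e \<in> padic_ball n" for n
    unfolding eventually_finite_subsets_at_top
  proof (intro exI[of _ B] conjI allI impI)
    fix B' assume "finite B' \<and> B \<subseteq> B' \<and> B' \<subseteq> UNIV"
    then have "(\<Sum>(i, j, k)\<in>B'. coeff3 F i j k * x ^ i * y ^ j * (1 / y) ^ k) = e"
      unfolding e using B(2) by (intro finite_value_sum_superset) auto
    then show "(\<Sum>(i, j, k)\<in>B'. coeff3 F i j k * x ^ i * y ^ j * (1 / y) ^ k) - e \<in> padic_ball n"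
      by simp
  qed (use B(1) in auto)
  ultimately show ?thesis
    unfolding dagger_value_def prod.case
    by (intro bexI[OF _ assms(1)] conjI ballI allI)
qed

definition odd_value :: "nat \<Rightarrow> 'a :: field \<Rightarrow> 'a" where
  "odd_value t y = (if t = 0 then y else (1 / y) ^ (2 * t - 1))"

lemma finite_value_odd_power:
  "finite_value (poly3 f * odd_power t) x y (1 / y) (poly f x * odd_value t y)"
proof (cases "t = 0")
  case True
  then show ?thesis
    using finite_value_poly3_monomial[of f 1 0 x y "1 / y"] by (simp add: odd_power_def odd_value_def)
next
  case False
  then show ?thesis
    using finite_value_poly3_monomial[of f 0 "2 * t - 1" x y "1 / y"]
    by (simp add: odd_power_def odd_value_def)
qed

section \<open>Forms modulo exact differentials, with recorded values\<close>

text \<open>The invariant of the whole reduction: \<open>G\<close> is the function subtracted so far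
  and \<open>e\<close> lists its values at the points. Values are taken on the series
  \<open>G\<close> itself rather than on its class, so that they add up under composition.\<close>

definition differs_by_exact ::
  "'p :: prime_card padic_int poly \<Rightarrow> nat \<Rightarrow> (nat \<Rightarrow> 'p padic \<times> 'p padic)
     \<Rightarrow> 'p padic fps3 \<Rightarrow> 'p padic fps3 \<Rightarrow> (nat \<Rightarrow> 'p padic) \<Rightarrow> bool" where
  "differs_by_exact Q L pt F F' e \<longleftrightarrow> (\<exists>G\<in>dagger_rat. curve_cong Q (F - d_series Q G) F'
     \<and> (\<forall>l<L. finite_value G (fst (pt l)) (snd (pt l)) (1 / snd (pt l)) (e l)))"

lemma differs_by_exact_refl: "differs_by_exact Q L pt F F (\<lambda>_. 0)"
  unfolding differs_by_exact_def
  by (intro bexI[of _ 0])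
    (simp_all add: derivation_zero[OF derivation_d_series] curve_cong_refl finite_value_0 dagger_rat_0)

lemma differs_by_exact_trans:
  assumes "differs_by_exact Q L pt F F' e" "differs_by_exact Q L pt F' F'' e'"
    and "\<And>l. l < L \<Longrightarrow> e'' l = e l + e' l"
  shows "differs_by_exact Q L pt F F'' e''"
proof -
  obtain G where G: "G \<in> dagger_rat" "curve_cong Q (F - d_series Q G) F'"
      "\<And>l. l < L \<Longrightarrow> finite_value G (fst (pt l)) (snd (pt l)) (1 / snd (pt l)) (e l)"
    using assms(1) unfolding differs_by_exact_def by blast
  obtain H where H: "H \<in> dagger_rat" "curve_cong Q (F' - d_series Q H) F''"
      "\<And>l. l < L \<Longrightarrow> finite_value H (fst (pt l)) (snd (pt l)) (1 / snd (pt l)) (e' l)"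
    using assms(2) unfolding differs_by_exact_def by blast
  have "F - d_series Q (G + H) = (F - d_series Q G) + - d_series Q H"
    by (simp add: derivation_add[OF derivation_d_series])
  also have "curve_cong Q \<dots> (F' + - d_series Q H)"
    by (intro curve_cong_add curve_cong_refl G(2))
  also have "F' + - d_series Q H = F' - d_series Q H" by simp
  also note H(2)
  finally show ?thesis
    unfolding differs_by_exact_def using G(1,3) H(1,3) assms(3)
    by (intro bexI[of _ "G + H"]) (simp_all add: finite_value_add dagger_rat_add)
qed

text \<open>One reduction step, subtracting \<open>d(f y^(1-2t))\<close>. The result is only
  required to be congruent to \<open>F'\<close>, so that a vertical step may also use
  \<open>Q * y^(-2) = 1\<close> to lower the pole order.\<close>

lemma differs_by_exact_poly3:
  assumes "a - b = 2 * pderiv f * ratpoly Q - of_int (2 * int t - 1) * f * pderiv (ratpoly Q)"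
    and "curve_cong Q (poly3 b * Z3 ^ (2 * t)) F'"
    and "\<And>l. l < L \<Longrightarrow> e l = poly f (fst (pt l)) * odd_value t (snd (pt l))"
  shows "differs_by_exact Q L pt (poly3 a * Z3 ^ (2 * t)) F' e"
proof -
  let ?G = "poly3 f * odd_power t"
  have "curve_cong Q (d_series Q ?G) (poly3 (a - b) * Z3 ^ (2 * t))"
    unfolding assms(1) by (rule d_series_poly3_odd_power)
  then have "curve_cong Q (poly3 b * Z3 ^ (2 * t)) (poly3 a * Z3 ^ (2 * t) - d_series Q ?G)"
    by (simp add: curve_cong_def poly3_diff algebra_simps)
  then have "curve_cong Q (poly3 a * Z3 ^ (2 * t) - d_series Q ?G) F'"
    using assms(2) by (metis curve_cong_sym curve_cong_trans)
  then show ?thesis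
    unfolding differs_by_exact_def using assms(3)
    by (intro bexI[of _ ?G])
      (simp_all add: finite_value_odd_power dagger_rat_mult dagger_rat_poly3 dagger_rat_odd_power)
qed

text \<open>\<open>x\<^sup>s f(x)\<close>, provided this is a polynomial: \<^const>\<open>nat\<close> truncates negative exponents.\<close>

definition laurent :: "int \<Rightarrow> 'a :: comm_ring_1 poly \<Rightarrow> 'a poly" where
  "laurent s f = (\<Sum>i\<le>degree f. monom (coeff f i) (nat (int i + s)))"

lemma diff_form_laurent:
  "diff_form Q s t f = dagger_class Q (poly3 (laurent s f) * Z3 ^ (2 * t))"
  by (simp add: diff_form_def laurent_def poly3_sum poly3_monom sum_distrib_right)

text \<open>Multiplication by x removes the possible exponent -1. Identities between
  \<open>laurent\<close> polynomials are later proved after this multiplication and then cancelled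
  by x.\<close>

lemma laurent_shift:
  assumes "s \<ge> -1" "s = -1 \<Longrightarrow> coeff f 0 = 0"
  shows "monom 1 1 * laurent s f = monom 1 (nat (s + 1)) * f"
proof -
  have "monom 1 1 * monom (coeff f i) (nat (int i + s)) = monom 1 (nat (s + 1)) * monom (coeff f i) i"
    for i
  proof (cases "int i + s \<ge> 0")
    case True
    then have "1 + nat (int i + s) = nat (s + 1) + i" using assms(1) by linarith
    then show ?thesis by (simp only: mult_monom)
  next
    case False
    \<comment> \<open>The only exponent truncated by \<open>nat\<close>; its coefficient is zero by
      assumption.\<close>
    then have "s = -1" "i = 0" using assms(1) by linarith+
    then show ?thesis using assms(2) by simp
  qed
  then have "monom 1 1 * laurent s f
      = monom 1 (nat (s + 1)) * (\<Sum>i\<le>degree f. monom (coeff f i) i)"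
    by (simp only: laurent_def sum_distrib_left)
  then show ?thesis by (simp only: poly_as_sum_of_monoms)
qed

section \<open>Coordinate vectors as polynomials\<close>

definition vec_poly :: "nat \<Rightarrow> 'a :: comm_monoid_add vec \<Rightarrow> 'a poly" where
  "vec_poly n v = (\<Sum>i<n. monom (vec_index v i) i)"

lemma coeff_vec_poly: "coeff (vec_poly n v) i = (if i < n then vec_index v i else 0)"
  by (simp add: vec_poly_def coeff_sum)

lemma from_horizontal_vec_poly:
  "from_horizontal g L Q s t v = (diff_form Q s t (vec_poly (2 * g + 1) v),
      vec L (\<lambda>l. vec_index v (2 * g + 1 + l)))"
  by (simp add: from_horizontal_def vec_poly_def lessThan_Suc_atMost)

lemma from_vertical_vec_poly:
  "from_vertical g L Q t v = (diff_form Q 0 t (vec_poly (2 * g) v),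
      vec L (\<lambda>l. vec_index v (2 * g + l)))"
  by (simp add: from_vertical_def vec_poly_def)

section \<open>Interval products and diagonal corrections\<close>

lemma foldr_mat_carrier:
  assumes "\<And>k. M k \<in> carrier_mat n n"
  shows "foldr (\<lambda>k N. M k * N) ks (1\<^sub>m n) \<in> carrier_mat n n"
  by (induction ks) (auto intro!: mult_carrier_mat assms)

lemma interval_product_carrier:
  assumes "\<And>k. M k \<in> carrier_mat n n"
  shows "interval_product n M a b \<in> carrier_mat n n"
  unfolding interval_product_def using assms by (rule foldr_mat_carrier)

lemma interval_product_mult_vec:
  assumes "\<And>k. M k \<in> carrier_mat n n" "v \<in> carrier_vec n"
  shows "interval_product n M a b *\<^sub>v v = foldr (\<lambda>k u. M k *\<^sub>v u) [a + 1..b] v"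
proof -
  have "foldr (\<lambda>k N. M k * N) ks (1\<^sub>m n) *\<^sub>v v = foldr (\<lambda>k u. M k *\<^sub>v u) ks v" for ks
    using assms(2)
    by (induction ks)
      (auto simp: assoc_mult_mat_vec[OF assms(1) foldr_mat_carrier[of M n, OF assms(1)] assms(2)])
  then show ?thesis by (simp add: interval_product_def)
qed

lemma interval_product_empty: "v \<in> carrier_vec n \<Longrightarrow> interval_product n M a a *\<^sub>v v = v"
  by (simp add: interval_product_def)

text \<open>The rightmost factor, of index \<open>b\<close>, acts on the vector first. Splitting it
  off is the induction step of both reductions.\<close>

lemma interval_product_last:
  assumes "\<And>k. M k \<in> carrier_mat n n" "v \<in> carrier_vec n" "a < b"
  shows "interval_product n M a b *\<^sub>v v = interval_product n M a (b - 1) *\<^sub>v (M b *\<^sub>v v)"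
proof -
  have "[a + 1..b] = [a + 1..b - 1] @ [b]" using assms(3) by (intro upto_rec2) simp
  moreover have "M b *\<^sub>v v \<in> carrier_vec n" by (rule mult_mat_vec_carrier[OF assms(1,2)])
  ultimately show ?thesis using assms by (simp add: interval_product_mult_vec)
qed

lemma smult_mat_mult_vec_index:
  assumes "i < n" "v \<in> carrier_vec n"
  shows "vec_index ((c \<cdot>\<^sub>m mat n n f) *\<^sub>v v) i = c * (\<Sum>j<n. f (i, j) * vec_index v j)"
  using assms by (simp add: scalar_prod_def sum_distrib_left atLeast0LessThan mult.assoc)

lemma correction_mult_vec:
  assumes "v \<in> carrier_vec (n + L)"
  shows "correction n L pt f *\<^sub>v v
    = vec (n + L) (\<lambda>i. if i < n then vec_index v i else f (pt (i - n)) * vec_index v i)"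
proof (rule eq_vecI)
  fix i assume "i < dim_vec (vec (n + L) (\<lambda>i. if i < n then vec_index v i else f (pt (i - n)) * vec_index v i))"
  then have i: "i < n + L" by simp
  have "vec_index (correction n L pt f *\<^sub>v v) i
      = (\<Sum>j<n + L. (if i \<noteq> j then 0 else if i < n then 1 else f (pt (i - n))) * vec_index v j)"
    using assms i by (simp add: correction_def scalar_prod_def atLeast0LessThan)
  also have "\<dots> = (\<Sum>j<n + L. if i = j then (if i < n then 1 else f (pt (i - n))) * vec_index v i else 0)"
    by (intro sum.cong) auto
  also have "\<dots> = (if i < n then vec_index v i else f (pt (i - n)) * vec_index v i)"
    using i by simp
  finally show "vec_index (correction n L pt f *\<^sub>v v) i = vec_index (vec (n + L)
      (\<lambda>i. if i < n then vec_index v i else f (pt (i - n)) * vec_index v i)) i"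
    using i by simp
qed (simp add: correction_def)

section \<open>The reduction steps\<close>

lemma sum_two_spikes:
  fixes n :: nat
  assumes "a < n" "b < n" "a \<noteq> b"
  shows "(\<Sum>j<n. if j = a then F j else if j = b then G j else 0) = F a + (G b :: 'a :: comm_monoid_add)"
proof -
  have "(\<Sum>j<n. if j = a then F j else if j = b then G j else 0)
      = (\<Sum>j<n. (if j = a then F j else 0) + (if j = b then G j else 0))"
    using assms(3) by (intro sum.cong) auto
  also have "\<dots> = F a + G b" using assms(1,2) by (simp add: sum.distrib)
  finally show ?thesis .
qed

lemma R_H_carrier: "R_H g L P pt t s \<in> carrier_mat (2 * g + 1 + L) (2 * g + 1 + L)"
  by (simp add: R_H_def M_H_def)

lemma R_V_carrier: "R_V g L R S pt t \<in> carrier_mat (2 * g + L) (2 * g + L)"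
  by (simp add: R_V_def M_V_def)

text \<open>After division by \<open>D_H\<close> the subdiagonal becomes a pure shift of the
  coefficients, while column \<open>2 * g\<close> redistributes the top one.\<close>

lemma R_H_mult_vec:
  fixes v :: "'p :: prime_card padic vec" and P pt
  assumes "v \<in> carrier_vec (2 * g + 1 + L)" "D_H g t s \<noteq> 0"
  defines "w \<equiv> R_H g L P pt t s *\<^sub>v v"
  shows "i \<le> 2 * g \<Longrightarrow> vec_index w i = p_H P t s i * vec_index v (2 * g) / of_int (D_H g t s)
      + (if i = 0 then 0 else vec_index v (i - 1))" (is "_ \<Longrightarrow> ?A")
    and "l < L \<Longrightarrow> vec_index w (2 * g + 1 + l) = - vec_index v (2 * g) / of_int (D_H g t s)
      + fst (pt l) * vec_index v (2 * g + 1 + l)" (is "_ \<Longrightarrow> ?B")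
proof -
  let ?n = "2 * g + 1 + L"
  let ?D = "of_int (D_H g t s) :: 'p padic"
  have D: "?D \<noteq> 0" using assms(2) by simp
  note idx = smult_mat_mult_vec_index[OF _ assms(1)]
  {
    assume i: "i \<le> 2 * g"
    have "vec_index w i = 1 / ?D * (\<Sum>j<?n. (if j = 2 * g then p_H P t s i
        else if i = j + 1 then ?D else 0) * vec_index v j)"
      unfolding w_def R_H_def M_H_def using i by (subst idx) (auto cong: if_cong)
    also have "(\<Sum>j<?n. (if j = 2 * g then p_H P t s i
        else if i = j + 1 then ?D else 0) * vec_index v j)
        = p_H P t s i * vec_index v (2 * g) + (if i = 0 then 0 else ?D * vec_index v (i - 1))"
    proof (cases i)
      case 0
      have "(\<Sum>j<?n. (if j = 2 * g then p_H P t s i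
          else if i = j + 1 then ?D else 0) * vec_index v j)
          = (\<Sum>j<?n. if j = 2 * g then p_H P t s i * vec_index v (2 * g) else 0)"
        using 0 by (intro sum.cong) auto
      then show ?thesis using 0 by simp
    next
      case (Suc m)
      have "(\<Sum>j<?n. (if j = 2 * g then p_H P t s i
          else if i = j + 1 then ?D else 0) * vec_index v j)
          = (\<Sum>j<?n. if j = 2 * g then p_H P t s i * vec_index v j
            else if j = m then ?D * vec_index v j else 0)"
        using Suc by (intro sum.cong) auto
      also have "\<dots> = p_H P t s i * vec_index v (2 * g) + ?D * vec_index v m"
        using Suc i by (intro sum_two_spikes) auto
      finally show ?thesis using Suc by simp
    qed
    finally show ?A using D by (auto simp: field_simps)
  }
  {
    assume l: "l < L"
    have "vec_index w (2 * g + 1 + l) = 1 / ?D * (\<Sum>j<?n. (if j = 2 * g then - 1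
        else if 2 * g + 1 + l = j then fst (pt l) * ?D else 0) * vec_index v j)"
      unfolding w_def R_H_def M_H_def using l
      by (subst idx) (simp, intro arg_cong2[where f = "(*)"] sum.cong refl, auto)
    also have "(\<Sum>j<?n. (if j = 2 * g then - 1
        else if 2 * g + 1 + l = j then fst (pt l) * ?D else 0) * vec_index v j)
        = (\<Sum>j<?n. if j = 2 * g then - vec_index v j
          else if j = 2 * g + 1 + l then fst (pt l) * ?D * vec_index v j else 0)"
      by (intro sum.cong) auto
    also have "\<dots> = - vec_index v (2 * g) + fst (pt l) * ?D * vec_index v (2 * g + 1 + l)"
      using l by (intro sum_two_spikes) auto
    finally show ?B using D by (simp add: field_simps)
  }
qed

lemma R_V_mult_vec:
  fixes v :: "'p :: prime_card padic vec" and R S pt t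
  assumes "v \<in> carrier_vec (2 * g + L)"
  defines "w \<equiv> R_V g L R S pt t *\<^sub>v v"
  shows "j < 2 * g \<Longrightarrow> vec_index w j = (\<Sum>i<2 * g. (coeff (R i) j
      + 2 / of_int (2 * t - 1) * coeff (pderiv (S i)) j) * vec_index v i)" (is "_ \<Longrightarrow> ?A")
    and "l < L \<Longrightarrow> vec_index w (2 * g + l)
      = - (\<Sum>i<2 * g. poly (S i) (fst (pt l)) * vec_index v i) / of_int (2 * t - 1)
        + vec_index v (2 * g + l) / snd (pt l) ^ 2" (is "_ \<Longrightarrow> ?B")
proof -
  let ?n = "2 * g + L"
  let ?D = "of_int (2 * t - 1) :: 'p padic"
  \<comment> \<open>An odd integer, so nonzero.\<close>
  have "2 * t - 1 \<noteq> 0" by presburger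
  then have D: "?D \<noteq> 0" by (simp only: of_int_padic_eq_0_iff not_False_eq_True)
  have cancel: "1 / ?D * ((?D * a + 2 * b) * c) = (a + 2 / ?D * b) * c" for a b c :: "'p padic"
  proof -
    have "1 / d * ((d * a + 2 * b) * c) = (a + 2 / d * b) * c" if "d \<noteq> 0" for d :: "'p padic"
      using that by (simp add: field_simps)
    from this[OF D] show ?thesis .
  qed
  note idx = smult_mat_mult_vec_index[OF _ assms(1)]
  have split: "(\<Sum>i<2 * g + m. F i) = (\<Sum>i<2 * g. F i) + (\<Sum>i<m. F (2 * g + i))"
    for F :: "nat \<Rightarrow> 'p padic" and m
    by (induction m) (simp_all add: add.assoc)
  {
    assume j: "j < 2 * g"
    have "vec_index w j = 1 / ?D * (\<Sum>i<?n. (if i < 2 * g then ?D * coeff (R i) j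
        + 2 * coeff (pderiv (S i)) j else 0) * vec_index v i)"
      unfolding w_def R_V_def M_V_def D_V_def using j by (subst idx) (auto cong: if_cong)
    also have "\<dots> = 1 / ?D * (\<Sum>i<2 * g. (?D * coeff (R i) j + 2 * coeff (pderiv (S i)) j) * vec_index v i)"
      unfolding split by simp
    also have "\<dots> = (\<Sum>i<2 * g. (coeff (R i) j + 2 / ?D * coeff (pderiv (S i)) j) * vec_index v i)"
      unfolding sum_distrib_left by (intro sum.cong refl cancel)
    finally show ?A .
  }
  {
    assume l: "l < L"
    have "vec_index w (2 * g + l) = 1 / ?D * (\<Sum>i<?n. (if i < 2 * g then - poly (S i) (fst (pt l))
        else if i = 2 * g + l then ?D / snd (pt l) ^ 2 else 0) * vec_index v i)"
      unfolding w_def R_V_def M_V_def D_V_def using l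
      by (subst idx) (simp, intro arg_cong2[where f = "(*)"] sum.cong refl, auto)
    also have "(\<Sum>i<?n. (if i < 2 * g then - poly (S i) (fst (pt l))
        else if i = 2 * g + l then ?D / snd (pt l) ^ 2 else 0) * vec_index v i)
      = - (\<Sum>i<2 * g. poly (S i) (fst (pt l)) * vec_index v i)
        + ?D / snd (pt l) ^ 2 * vec_index v (2 * g + l)"
    proof -
      have "(\<Sum>i<L. (if i = l then c else 0) * F i) = c * F l" for c and F :: "nat \<Rightarrow> 'p padic"
        using l by (simp add: if_distrib[of "\<lambda>x. x * _"] cong: if_cong)
      from this[of "?D / snd (pt l) ^ 2" "\<lambda>i. vec_index v (2 * g + i)"]
      show ?thesis unfolding split by (simp add: sum_negf)
    qed
    also have "1 / ?D * \<dots> = - (\<Sum>i<2 * g. poly (S i) (fst (pt l)) * vec_index v i) / ?D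
        + vec_index v (2 * g + l) / snd (pt l) ^ 2"
      using D by (simp only: distrib_left times_divide_eq_left times_divide_eq_right mult_1_left
        nonzero_mult_div_cancel_left divide_divide_eq_left) (simp add: divide_simps)
    finally show ?B .
  }
qed

section \<open>The horizontal reduction\<close>

lemma pderiv_monom_1_mult: "monom 1 1 * pderiv (monom c n) = Polynomial.smult (of_nat n) (monom c n)"
  by (cases n) (simp_all add: pderiv_monom mult_monom Polynomial.smult_monom)

lemma ratpoly_of_int: "ratpoly (of_int m) = of_int m"
  by (simp add: poly_eq_iff of_int_poly coeff_map_poly coeff_pCons to_fract_of_int split: nat.split)

lemma of_int_mult_poly: "of_int m * (f :: 'a :: comm_ring_1 poly) = Polynomial.smult (of_int m) f"
  by (simp add: of_int_poly)

lemma ratpoly_monom: "ratpoly (monom c n) = monom (to_fract c) n"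
  by (simp add: map_poly_monom)

text \<open>In \<open>2sQ - (2t-1)xQ'\<close> the coefficient of \<open>x^(2g+1)\<close> is
  \<open>2s - (2t-1)(2g+1) = -D_H\<close>, and the contribution of \<open>P\<close> is exactly the
  polynomial \<open>q\<close> with coefficients \<open>p_H\<close>.\<close>

lemma p_H_poly:
  fixes P Q :: "'p :: prime_card padic_int poly"
  assumes "Q = monom 1 (2 * g + 1) + P" "degree P \<le> 2 * g"
  obtains q :: "'p padic poly" where "\<And>i. coeff q i = p_H P t s i" "degree q \<le> 2 * g"
    "of_int (D_H g t s) * monom 1 (2 * g + 1) - q
      = of_int (2 * int t - 1) * (monom 1 1 * pderiv (ratpoly Q)) - of_int (2 * s) * ratpoly Q"
proof -
  let ?q = "of_int (2 * s) * P - of_int (2 * int t - 1) * (monom 1 1 * pderiv P)"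
  have "degree (monom 1 1 * pderiv P) \<le> 2 * g"
  proof (cases "pderiv P = 0")
    case False
    \<comment> \<open>This keeps \<open>degree P - 1\<close> in the degree bound from
      truncating.\<close>
    have "degree P \<noteq> 0"
    proof
      assume "degree P = 0"
      then obtain c where "P = [:c:]" by (rule degree_eq_zeroE)
      then show False using False by (simp add: pderiv_pCons)
    qed
    moreover have "degree (monom 1 1 * pderiv P) \<le> 1 + (degree P - 1)"
      by (intro order.trans[OF degree_mult_le] add_mono degree_monom_le degree_pderiv_le)
    ultimately show ?thesis using assms(2) by linarith
  qed simp
  then have "degree ?q \<le> 2 * g"
    using assms(2) unfolding of_int_mult_poly
    by (intro degree_diff_le order.trans[OF degree_smult_le])
  then have deg: "degree (ratpoly ?q) \<le> 2 * g" by (rule order.trans[OF degree_map_poly_le])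
  let ?c = "of_int (2 * int t - 1) :: 'p padic poly"
  have Q: "ratpoly Q = monom 1 (2 * g + 1) + ratpoly P"
    unfolding assms(1) by (simp add: ratpoly_monom)
  have "monom 1 1 * pderiv (monom (1 :: 'p padic) (2 * g + 1)) = of_int (2 * int g + 1) * monom 1 (2 * g + 1)"
    unfolding pderiv_monom_1_mult of_int_mult_poly by (simp add: add.commute)
  then have Q': "monom 1 1 * pderiv (ratpoly Q)
      = of_int (2 * int g + 1) * monom 1 (2 * g + 1) + monom 1 1 * pderiv (ratpoly P)"
    by (simp only: Q pderiv_add distrib_left)
  have q: "ratpoly ?q = of_int (2 * s) * ratpoly P - ?c * (monom 1 1 * pderiv (ratpoly P))"
    by (simp only: fract_poly_diff fract_poly_mult ratpoly_of_int ratpoly_pderiv ratpoly_monom to_fract_1)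
  have D: "of_int (D_H g t s) = ?c * of_int (2 * int g + 1) - of_int (2 * s)"
    by (simp only: D_H_def of_int_diff of_int_mult)
  have "(c * k - a) * m - (a * r - c * y) = c * (k * m + y) - a * (m + r)"
    for a c k m r y :: "'p padic poly"
    by (simp add: algebra_simps)
  then have "of_int (D_H g t s) * monom 1 (2 * g + 1) - ratpoly ?q
      = ?c * (monom 1 1 * pderiv (ratpoly Q)) - of_int (2 * s) * ratpoly Q"
    unfolding D q Q' unfolding Q .
  moreover have "coeff (ratpoly ?q) i = p_H P t s i" for i
    unfolding p_H_def by (rule coeff_map_poly[of to_fract, OF to_fract_0])
  ultimately show ?thesis using deg by (intro that)
qed

text \<open>The multiple of \<open>x^n y^(1-2t)\<close> subtracted is chosen to cancel the top
  coefficient; its scalar \<open>-a/D\<close> is what the entry -1 in column \<open>2 * g\<close>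
  records at each point.\<close>

lemma horizontal_step:
  fixes P Q :: "'p :: prime_card padic_int poly" and v :: "'p padic vec" and pt
  assumes Q: "Q = monom 1 (2 * g + 1) + P" "degree P \<le> 2 * g"
    and v: "v \<in> carrier_vec (2 * g + 1 + L)" and D: "D_H g t (int n) \<noteq> 0"
  defines "w \<equiv> R_H g L P pt t (int n) *\<^sub>v v"
  shows "n = 0 \<Longrightarrow> vec_index w 0 = 0" (is "_ \<Longrightarrow> ?A")
    and "differs_by_exact Q L pt
      (poly3 (laurent (int n) (vec_poly (2 * g + 1) v)) * Z3 ^ (2 * t))
      (poly3 (laurent (int n - 1) (vec_poly (2 * g + 1) w)) * Z3 ^ (2 * t))
      (\<lambda>l. - vec_index v (2 * g) / of_int (D_H g t (int n)) * fst (pt l) ^ n * odd_value t (snd (pt l)))"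
    (is ?B)
proof -
  let ?D = "of_int (D_H g t (int n)) :: 'p padic"
  let ?a = "vec_index v (2 * g)"
  let ?x = "monom 1 1 :: 'p padic poly"
  let ?f = "vec_poly (2 * g + 1) v" and ?f' = "vec_poly (2 * g + 1) w"
  have D0: "?D \<noteq> 0" using D by simp
  obtain q where q: "\<And>i. coeff q i = p_H P t (int n) i" "degree q \<le> 2 * g"
    and q_eq: "of_int (D_H g t (int n)) * monom 1 (2 * g + 1) - q
      = of_int (2 * int t - 1) * (monom 1 1 * pderiv (ratpoly Q)) - of_int (2 * int n) * ratpoly Q"
    using p_H_poly[OF Q, of t "int n"] by blast
  note w = R_H_mult_vec(1)[OF v D, of _ P pt, folded w_def]
  show A: ?A if "n = 0"
  proof -
    \<comment> \<open>For \<open>n = 0\<close> only the multiple of \<open>x * P'\<close> remains,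
      and it has no constant term.\<close>
    have "p_H P t (int n) 0 = 0" using that unfolding p_H_def of_int_mult_poly by (simp add: coeff_monom_mult)
    then show ?thesis using w[of 0] by simp
  qed
  \<comment> \<open>The shift in \<open>?f'\<close> cancels all coefficients of
    \<open>?x * ?f\<close> but the top one.\<close>
  have ff': "?x * ?f - ?f' = Polynomial.smult (?a / ?D) (of_int (D_H g t (int n)) * monom 1 (2 * g + 1) - q)"
  proof (rule poly_eqI)
    fix i
    have "coeff q i = 0" if "i > 2 * g" using q(2) that by (simp add: coeff_eq_0)
    then show "coeff (?x * ?f - ?f') i
        = coeff (Polynomial.smult (?a / ?D) (of_int (D_H g t (int n)) * monom 1 (2 * g + 1) - q)) i"
      using D0 w[of i]
      by (auto simp: coeff_monom_mult coeff_vec_poly of_int_mult_poly q(1) field_simps)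
  qed
  have shift: "?x * laurent (int n) ?f = monom 1 n * (?x * ?f)"
    using laurent_shift[of "int n" ?f] by (simp add: nat_add_distrib mult_monom flip: mult.assoc)
  have shift': "?x * laurent (int n - 1) ?f' = monom 1 n * ?f'"
    using laurent_shift[of "int n - 1" ?f'] A by (simp add: coeff_vec_poly)
  let ?h = "Polynomial.smult (- ?a / ?D) (monom 1 n)"
  have x0: "?x \<noteq> 0" by simp
  have "?x * (laurent (int n) ?f - laurent (int n - 1) ?f') = monom 1 n * (?x * ?f - ?f')"
    by (simp only: right_diff_distrib shift shift')
  also have "\<dots> = ?h * (of_int (2 * int n) * ratpoly Q - of_int (2 * int t - 1) * (?x * pderiv (ratpoly Q)))"
  proof -
    have neg: "?h = - Polynomial.smult (?a / ?D) (monom 1 n)"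
      by (simp only: minus_divide_left[symmetric] smult_minus_left)
    have "m * Polynomial.smult k (a - b) = - Polynomial.smult k m * (b - a)"
      for m a b :: "'p padic poly" and k
      by (simp add: algebra_simps smult_diff_right)
    then show ?thesis unfolding ff' q_eq neg .
  qed
  also have "\<dots> = ?x * (2 * pderiv ?h * ratpoly Q - of_int (2 * int t - 1) * ?h * pderiv (ratpoly Q))"
  proof -
    \<comment> \<open>The operator \<open>x d/dx\<close> multiplies \<open>x^n\<close> by
      \<open>n\<close>, which accounts for the term \<open>2nQ\<close>.\<close>
    have h: "?x * pderiv ?h = of_int (int n) * ?h"
      by (simp only: pderiv_smult mult_smult_right pderiv_monom_1_mult of_int_mult_poly smult_smult)
        (simp add: mult.commute)
    have "x * (2 * h' * r - c * h * r') = h * (2 * m * r - c * (x * r'))"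
      if "x * h' = m * h" for x h h' m r r' c :: "'p padic poly"
    proof -
      have "x * (2 * h' * r - c * h * r') = 2 * (x * h') * r - c * h * (x * r')"
        by (simp add: algebra_simps)
      then show ?thesis unfolding that by (simp add: algebra_simps)
    qed
    moreover have "of_int (2 * int n) = (2 :: 'p padic poly) * of_int (int n)" by simp
    ultimately show ?thesis using h by (simp only:)
  qed
  finally have "laurent (int n) ?f - laurent (int n - 1) ?f'
      = 2 * pderiv ?h * ratpoly Q - of_int (2 * int t - 1) * ?h * pderiv (ratpoly Q)"
    unfolding mult_left_cancel[OF x0] .
  then show ?B
    by (rule differs_by_exact_poly3[OF _ curve_cong_refl]) (simp add: poly_monom)
qed

text \<open>Induction on the number \<open>n = s + 1\<close> of steps. Each later step multiplies
  the recorded values by \<open>x\<close>, in line with the decreasing powers \<open>x^s\<close>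
  subtracted; the common factor \<open>y^(1-2t)\<close> stays outside the coordinates.\<close>

lemma horizontal_reduction:
  fixes P Q :: "'p :: prime_card padic_int poly" and v :: "'p padic vec"
  assumes Q: "Q = monom 1 (2 * g + 1) + P" "degree P \<le> 2 * g"
    and "v \<in> carrier_vec (2 * g + 1 + L)" and "\<forall>k<n. D_H g t (int k) \<noteq> 0"
    and "n = 0 \<Longrightarrow> vec_index v 0 = 0"
    and "w = interval_product (2 * g + 1 + L) (R_H g L P pt t) (-1) (int n - 1) *\<^sub>v v"
  shows "vec_index w 0 = 0 \<and> differs_by_exact Q L pt
      (poly3 (laurent (int n - 1) (vec_poly (2 * g + 1) v)) * Z3 ^ (2 * t))
      (poly3 (laurent (- 1) (vec_poly (2 * g + 1) w)) * Z3 ^ (2 * t))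
      (\<lambda>l. (vec_index w (2 * g + 1 + l) - fst (pt l) ^ n * vec_index v (2 * g + 1 + l))
        * odd_value t (snd (pt l)))"
  using assms(3-)
proof (induction n arbitrary: v)
  case 0
  then have "w = v" by (simp add: interval_product_empty)
  then show ?case using 0 differs_by_exact_refl by simp
next
  case (Suc n)
  let ?u = "R_H g L P pt t (int n) *\<^sub>v v"
  have D: "D_H g t (int n) \<noteq> 0" using Suc.prems by simp
  note step = horizontal_step[OF Q Suc.prems(1) D, of pt]
  have u: "?u \<in> carrier_vec (2 * g + 1 + L)"
    by (rule mult_mat_vec_carrier[OF R_H_carrier Suc.prems(1)])
  have "w = interval_product (2 * g + 1 + L) (R_H g L P pt t) (-1) (int n - 1) *\<^sub>v ?u"
    unfolding Suc.prems(4)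
    using interval_product_last[where M = "R_H g L P pt t", OF R_H_carrier Suc.prems(1), of "-1" "int n"] by simp
  \<comment> \<open>If no step is left, the induction hypothesis asks for a zero constant
    coefficient; \<open>step(1)\<close> provides it.\<close>
  then have IH: "vec_index w 0 = 0 \<and> differs_by_exact Q L pt
      (poly3 (laurent (int n - 1) (vec_poly (2 * g + 1) ?u)) * Z3 ^ (2 * t))
      (poly3 (laurent (- 1) (vec_poly (2 * g + 1) w)) * Z3 ^ (2 * t))
      (\<lambda>l. (vec_index w (2 * g + 1 + l) - fst (pt l) ^ n * vec_index ?u (2 * g + 1 + l))
        * odd_value t (snd (pt l)))"
    using u step(1) Suc.prems(2) by (intro Suc.IH) auto
  have "differs_by_exact Q L pt
      (poly3 (laurent (int n) (vec_poly (2 * g + 1) v)) * Z3 ^ (2 * t))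
      (poly3 (laurent (- 1) (vec_poly (2 * g + 1) w)) * Z3 ^ (2 * t))
      (\<lambda>l. (vec_index w (2 * g + 1 + l) - fst (pt l) ^ Suc n * vec_index v (2 * g + 1 + l))
        * odd_value t (snd (pt l)))"
    using step(2) IH[THEN conjunct2]
    by (rule differs_by_exact_trans)
      (simp only: R_H_mult_vec(2)[OF Suc.prems(1) D], simp add: algebra_simps)
  then show ?case using IH by simp
qed

section \<open>The vertical reduction\<close>

text \<open>Write \<open>x^i = R_i Q + S_i Q'\<close>. Adding
  \<open>d(S_i y^(1-2T)) / (2T-1)\<close>, with \<open>T = Suc t\<close>, trades
  \<open>S_i Q'\<close> for \<open>2 S_i' Q / (2T-1)\<close>; everything left is then divisible by
  \<open>Q\<close>, which lowers the pole order by 2.\<close>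

lemma vertical_step:
  fixes Q :: "'p :: prime_card padic_int poly" and v :: "'p padic vec" and pt t
  assumes RS: "\<forall>i<2 * g. monom 1 i = R i * ratpoly Q + S i * pderiv (ratpoly Q)
      \<and> degree (R i) \<le> 2 * g - 1 \<and> degree (S i) \<le> 2 * g"
    and v: "v \<in> carrier_vec (2 * g + L)"
  defines "w \<equiv> R_V g L R S pt (int (Suc t)) *\<^sub>v v"
  shows "differs_by_exact Q L pt
      (poly3 (vec_poly (2 * g) v) * Z3 ^ (2 * Suc t)) (poly3 (vec_poly (2 * g) w) * Z3 ^ (2 * t))
      (\<lambda>l. (vec_index w (2 * g + l) - vec_index v (2 * g + l) / snd (pt l) ^ 2)
        * odd_value (Suc t) (snd (pt l)))"
proof -
  let ?d = "2 * int (Suc t) - 1"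
  let ?D = "of_int ?d :: 'p padic"
  let ?Q = "ratpoly Q"
  have "?d \<noteq> 0" by presburger
  then have D: "?D \<noteq> 0" by (simp only: of_int_padic_eq_0_iff not_False_eq_True)
  define h where "h = Polynomial.smult (- 1 / ?D) (\<Sum>i<2 * g. Polynomial.smult (vec_index v i) (S i))"
  have w: "vec_poly (2 * g) w = (\<Sum>i<2 * g. Polynomial.smult (vec_index v i)
      (R i + Polynomial.smult (2 / ?D) (pderiv (S i))))"
  proof (rule poly_eqI)
    fix j
    show "coeff (vec_poly (2 * g) w) j = coeff (\<Sum>i<2 * g. Polynomial.smult (vec_index v i)
        (R i + Polynomial.smult (2 / ?D) (pderiv (S i)))) j"
    proof (cases "j < 2 * g")
      case True
      have "vec_index w j = (\<Sum>i<2 * g. (coeff (R i) j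
          + 2 / ?D * coeff (pderiv (S i)) j) * vec_index v i)"
        unfolding w_def by (rule R_V_mult_vec(1)[OF v True])
      then show ?thesis
        using True by (simp only: coeff_vec_poly coeff_sum coeff_smult coeff_add if_True mult.commute)
    next
      case False
      \<comment> \<open>The degree bounds on \<open>R i\<close> and \<open>S i\<close> ensure that
        no coefficient is lost by keeping only \<open>2 * g\<close> coordinates.\<close>
      have "coeff (R i) j = 0 \<and> coeff (pderiv (S i)) j = 0" if "i < 2 * g" for i
        using RS[rule_format, OF that] False that by (auto simp: coeff_pderiv intro!: coeff_eq_0 disjI2)
      then show ?thesis
        using False by (simp add: coeff_vec_poly coeff_sum)
    qed
  qed
  have "vec_poly (2 * g) v - ?Q * vec_poly (2 * g) w
      = (\<Sum>i<2 * g. Polynomial.smult (vec_index v i) (monom 1 i - ?Q * (R i + Polynomial.smult (2 / ?D) (pderiv (S i)))))"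
    unfolding w by (simp add: vec_poly_def sum_distrib_left sum_subtractf smult_diff_right Polynomial.smult_monom)
  also have "\<dots> = (\<Sum>i<2 * g. Polynomial.smult (vec_index v i)
      (Polynomial.smult (- 1 / ?D) (2 * pderiv (S i) * ?Q - of_int ?d * S i * pderiv ?Q)))"
  proof (rule sum.cong[OF refl])
    fix i assume "i \<in> {..<2 * g}"
    then have RS_i: "monom 1 i = R i * ?Q + S i * pderiv ?Q" using RS by simp
    have cancel: "r * q + s * q' - q * (r + Polynomial.smult (2 / d) s')
        = Polynomial.smult (- 1 / d) (2 * s' * q - Polynomial.smult d (s * q'))"
      if "d \<noteq> 0" for r s q q' s' :: "'p padic poly" and d
    proof -
      have two: "2 * f = Polynomial.smult 2 f" for f :: "'p padic poly"
        by (metis mult_2 one_add_one smult_1_left smult_add_left)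
      have "Polynomial.smult (- 1 / d) (2 * s' * q - Polynomial.smult d (s * q'))
          = s * q' - Polynomial.smult (2 / d) (s' * q)"
        using that by (simp add: mult.assoc two smult_diff_right)
      then show ?thesis by (simp add: algebra_simps)
    qed
    show "Polynomial.smult (vec_index v i) (monom 1 i - ?Q * (R i + Polynomial.smult (2 / ?D) (pderiv (S i))))
        = Polynomial.smult (vec_index v i)
          (Polynomial.smult (- 1 / ?D) (2 * pderiv (S i) * ?Q - of_int ?d * S i * pderiv ?Q))"
      by (simp only: RS_i cancel[OF D] of_int_mult_poly mult_smult_left)
  qed
  also have "\<dots> = 2 * pderiv h * ?Q - of_int ?d * h * pderiv ?Q"
    unfolding h_def
    by (simp only: of_int_mult_poly pderiv_smult pderiv_sum smult_sum2 sum_distrib_left sum_distrib_right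
        mult_smult_left mult_smult_right smult_smult sum_subtractf[symmetric] smult_diff_right mult.commute)
  finally have eq: "vec_poly (2 * g) v - ?Q * vec_poly (2 * g) w
      = 2 * pderiv h * ?Q - of_int ?d * h * pderiv ?Q" .
  have "curve_cong Q (poly3 (vec_poly (2 * g) w) * (poly3 ?Q * Z3 ^ (2 * t + 2)))
      (poly3 (vec_poly (2 * g) w) * Z3 ^ (2 * t))"
    by (intro curve_cong_mult poly3_Z3_cong dagger_rat_poly3)
  then have cong: "curve_cong Q (poly3 (?Q * vec_poly (2 * g) w) * Z3 ^ (2 * Suc t))
      (poly3 (vec_poly (2 * g) w) * Z3 ^ (2 * t))"
    by (simp add: poly3_mult mult_ac)
  show ?thesis
  proof (rule differs_by_exact_poly3[OF eq cong])
    fix l assume l: "l < L"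
    have "vec_index w (2 * g + l) = - (\<Sum>i<2 * g. poly (S i) (fst (pt l)) * vec_index v i) / ?D
        + vec_index v (2 * g + l) / snd (pt l) ^ 2"
      unfolding w_def by (rule R_V_mult_vec(2)[OF v l])
    moreover have "poly h (fst (pt l)) = - (\<Sum>i<2 * g. poly (S i) (fst (pt l)) * vec_index v i) / ?D"
      unfolding h_def by (simp add: poly_sum mult.commute)
    ultimately show "(vec_index w (2 * g + l) - vec_index v (2 * g + l) / snd (pt l) ^ 2)
        * odd_value (Suc t) (snd (pt l)) = poly h (fst (pt l)) * odd_value (Suc t) (snd (pt l))"
      by simp
  qed
qed

text \<open>A step at \<open>T\<close> contributes a factor \<open>y^(1-2T)\<close>, of which the
  remaining \<open>T - 1\<close> steps produce \<open>y^(-2(T-1))\<close>. The factor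
  \<open>1/y\<close> left over is the same for all steps.\<close>

lemma vertical_reduction:
  fixes Q :: "'p :: prime_card padic_int poly" and v :: "'p padic vec"
  assumes RS: "\<forall>i<2 * g. monom 1 i = R i * ratpoly Q + S i * pderiv (ratpoly Q)
      \<and> degree (R i) \<le> 2 * g - 1 \<and> degree (S i) \<le> 2 * g"
    and "v \<in> carrier_vec (2 * g + L)"
    and "w = interval_product (2 * g + L) (R_V g L R S pt) 0 (int t) *\<^sub>v v"
  shows "differs_by_exact Q L pt
      (poly3 (vec_poly (2 * g) v) * Z3 ^ (2 * t)) (poly3 (vec_poly (2 * g) w) * Z3 ^ (2 * 0))
      (\<lambda>l. (vec_index w (2 * g + l) - vec_index v (2 * g + l) / snd (pt l) ^ (2 * t)) / snd (pt l))"
  using assms(2-)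
proof (induction t arbitrary: v)
  case 0
  then have "w = v" by (simp add: interval_product_empty)
  then show ?case using differs_by_exact_refl by simp
next
  case (Suc t)
  let ?u = "R_V g L R S pt (int (Suc t)) *\<^sub>v v"
  have u: "?u \<in> carrier_vec (2 * g + L)"
    by (rule mult_mat_vec_carrier[OF R_V_carrier Suc.prems(1)])
  have "w = interval_product (2 * g + L) (R_V g L R S pt) 0 (int t) *\<^sub>v ?u"
    unfolding Suc.prems(2)
    using interval_product_last[where M = "R_V g L R S pt", OF R_V_carrier Suc.prems(1), of 0 "int (Suc t)"]
    by simp
  note IH = Suc.IH[OF u this]
  have "odd_value (Suc t) y = 1 / (y ^ (2 * t) * y)" for y :: "'p padic"
    by (simp add: odd_value_def power_one_over)
  \<comment> \<open>For \<open>y = 0\<close> both sides are 0, by the convention for division by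
    zero.\<close>
  then have *: "(w' - v' / y ^ (2 * Suc t)) / y
      = (u' - v' / y ^ 2) * odd_value (Suc t) y + (w' - u' / y ^ (2 * t)) / y" for w' v' u' y :: "'p padic"
    by (cases "y = 0") (simp_all add: field_simps power2_eq_square power_add)
  show ?case
    by (rule differs_by_exact_trans[OF vertical_step[OF RS Suc.prems(1), of pt t] IH]) (rule *)
qed

section \<open>The main theorem\<close>

text \<open>\<open>f\<close> with exponent shift 0 is \<open>x * f\<close> with shift -1, and
  \<open>x * f\<close> has zero constant term and degree at most \<open>2 * g\<close>.\<close>

lemma diff_form_in_W_space:
  "diff_form Q 0 0 (vec_poly (2 * g) v) \<in> W_space g Q (-1) 0"
proof -
  let ?f = "vec_poly (2 * g) v"
  let ?x = "monom 1 1 :: 'a padic poly"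
  have x0: "?x \<noteq> 0" by simp
  have "?x * laurent (-1) (?x * ?f) = ?x * ?f"
    using laurent_shift[of "-1" "?x * ?f"] by (simp add: coeff_monom_mult)
  moreover have "?x * laurent 0 ?f = ?x * ?f"
    using laurent_shift[of 0 ?f] by simp
  ultimately have "laurent (-1) (?x * ?f) = laurent 0 ?f"
    using mult_left_cancel[OF x0] by metis
  then have "diff_form Q 0 0 ?f = diff_form Q (-1) 0 (?x * ?f)"
    by (simp add: diff_form_laurent)
  moreover have "degree (?x * ?f) \<le> 2 * g"
    by (rule degree_le) (auto simp: coeff_monom_mult coeff_vec_poly)
  moreover have "coeff (?x * ?f) 0 = 0" by (simp add: coeff_monom_mult)
  ultimately show ?thesis unfolding W_space_def by blast
qed

lemma laurent_0: "laurent 0 f = f"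
  by (simp add: laurent_def poly_as_sum_of_monoms)

text \<open>The index shift is division by x. Only the polynomial coordinates of \<open>u\<close>
  and \<open>w\<close> must agree, so the correction factor may intervene between them.\<close>

lemma laurent_horizontal_to_vertical:
  assumes "vec_index w 0 = 0" "\<And>i. i \<le> 2 * g \<Longrightarrow> vec_index u i = vec_index w i"
  shows "laurent (-1) (vec_poly (2 * g + 1) w)
    = vec_poly (2 * g) (horizontal_to_vertical g L u :: 'a :: idom vec)"
proof -
  let ?x = "monom 1 1 :: 'a poly"
  have x0: "?x \<noteq> 0" by simp
  have "?x * laurent (-1) (vec_poly (2 * g + 1) w) = vec_poly (2 * g + 1) w"
    using laurent_shift[of "-1" "vec_poly (2 * g + 1) w"] assms(1) by (simp add: coeff_vec_poly)
  also have "\<dots> = ?x * vec_poly (2 * g) (horizontal_to_vertical g L u)"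
    by (rule poly_eqI)
      (use assms in \<open>auto simp: coeff_monom_mult coeff_vec_poly horizontal_to_vertical_def not_le\<close>)
  finally show ?thesis unfolding mult_left_cancel[OF x0] .
qed

section \<open>Composition of the two reductions\<close>

theorem theorem4p4:
  fixes g L t :: nat and s :: int
    and P Q :: "'p :: prime_card padic_int poly"
    and R S :: "nat \<Rightarrow> 'p padic poly"
    and pt :: "nat \<Rightarrow> 'p padic \<times> 'p padic"
    and \<omega> :: "'p padic fps3 set" and h :: "'p padic vec"
  assumes "g \<ge> 1"
    and "Q = monom 1 (2 * g + 1) + P" and "degree P \<le> 2 * g"
    and "squarefree (map_poly padic_residue Q)"
    and "\<forall>l<L. pt l \<in> affine_points Q \<and> snd (pt l) \<noteq> 0"
    and "\<forall>i<2 * g. monom 1 i = R i * ratpoly Q + S i * pderiv (ratpoly Q)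
           \<and> degree (R i) \<le> 2 * g - 1 \<and> degree (S i) \<le> 2 * g"
    and "s \<ge> -1" and "\<forall>s'\<in>{0..s}. D_H g t s' \<noteq> 0"
    and "\<omega> \<in> W_space g Q s t"
    and "h \<in> carrier_vec (2 * g + 1 + L)" and "s = -1 \<longrightarrow> vec_index h 0 = 0"
    and "from_horizontal g L Q s t h = (\<omega>, 0\<^sub>v L)"
  shows "\<exists>\<omega>' e.
     from_vertical g L Q 0
       (correction (2 * g) L pt (\<lambda>(x, y). 1 / y) *\<^sub>v
         (interval_product (2 * g + L) (R_V g L R S pt) 0 (int t) *\<^sub>v
           horizontal_to_vertical g L
             (correction (2 * g + 1) L pt (\<lambda>(x, y). y ^ 2) *\<^sub>v
               (interval_product (2 * g + 1 + L) (R_H g L P pt t) (-1) s *\<^sub>v h)))) = (\<omega>', e)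
     \<and> \<omega>' \<in> W_space g Q (-1) 0
     \<and> (\<exists>G\<in>carrier (dagger_algebra Q).
          \<omega>' = \<omega> \<ominus>\<^bsub>dagger_algebra Q\<^esub> d_dagger Q G
          \<and> (\<forall>l<L. dagger_value G (pt l) (vec_index e l)))"
proof -
  define w where "w = interval_product (2 * g + 1 + L) (R_H g L P pt t) (-1) s *\<^sub>v h"
  define u where "u = correction (2 * g + 1) L pt (\<lambda>(x, y). y ^ 2) *\<^sub>v w"
  define v where "v = horizontal_to_vertical g L u"
  define z where "z = interval_product (2 * g + L) (R_V g L R S pt) 0 (int t) *\<^sub>v v"
  define c where "c = correction (2 * g) L pt (\<lambda>(x, y). 1 / y) *\<^sub>v z"
  define e where "e = vec L (\<lambda>l. vec_index c (2 * g + l))"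
  \<comment> \<open>The number of horizontal steps; \<open>s = -1\<close> means none.\<close>
  define n where "n = nat (s + 1)"
  have s: "s = int n - 1" using assms(7) by (simp add: n_def)
  have w: "w \<in> carrier_vec (2 * g + 1 + L)"
    unfolding w_def by (rule mult_mat_vec_carrier[OF interval_product_carrier[OF R_H_carrier] assms(10)])
  have u: "vec_index u i = (if i < 2 * g + 1 then vec_index w i
      else snd (pt (i - (2 * g + 1))) ^ 2 * vec_index w i)" if "i < 2 * g + 1 + L" for i
    unfolding u_def correction_mult_vec[OF w] using that by (simp add: case_prod_unfold)
  have v: "v \<in> carrier_vec (2 * g + L)" by (simp add: v_def horizontal_to_vertical_def)
  have z: "z \<in> carrier_vec (2 * g + L)"
    unfolding z_def by (rule mult_mat_vec_carrier[OF interval_product_carrier[OF R_V_carrier] v])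
  have c: "vec_index c i = (if i < 2 * g then vec_index z i
      else 1 / snd (pt (i - 2 * g)) * vec_index z i)" if "i < 2 * g + L" for i
    unfolding c_def correction_mult_vec[OF z] using that by (simp add: case_prod_unfold)
  have h\<omega>: "\<omega> = diff_form Q s t (vec_poly (2 * g + 1) h)"
    using assms(12) by (simp add: from_horizontal_vec_poly)
  have hl: "vec_index h (2 * g + 1 + l) = 0" if "l < L" for l
  proof -
    have "vec L (\<lambda>l. vec_index h (2 * g + 1 + l)) = 0\<^sub>v L"
      using assms(12) by (simp add: from_horizontal_vec_poly)
    then have "vec_index (vec L (\<lambda>l. vec_index h (2 * g + 1 + l))) l = vec_index (0\<^sub>v L) l"
      by (rule arg_cong)
    then show ?thesis using that by simp
  qed
  have hor: "vec_index w 0 = 0 \<and> differs_by_exact Q L pt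
      (poly3 (laurent (int n - 1) (vec_poly (2 * g + 1) h)) * Z3 ^ (2 * t))
      (poly3 (laurent (- 1) (vec_poly (2 * g + 1) w)) * Z3 ^ (2 * t))
      (\<lambda>l. (vec_index w (2 * g + 1 + l) - fst (pt l) ^ n * vec_index h (2 * g + 1 + l))
        * odd_value t (snd (pt l)))"
    using assms(8,11) s
    by (intro horizontal_reduction[OF assms(2,3,10)]) (auto simp: w_def)
  have shift: "laurent (- 1) (vec_poly (2 * g + 1) w) = vec_poly (2 * g) v"
    unfolding v_def by (rule laurent_horizontal_to_vertical) (use hor u in auto)
  have v_l: "vec_index v (2 * g + l) = snd (pt l) ^ 2 * vec_index w (2 * g + 1 + l)" if "l < L" for l
    using u[of "2 * g + 1 + l"] that by (simp add: v_def horizontal_to_vertical_def)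
  have e_l: "vec_index e l = vec_index z (2 * g + l) / snd (pt l)" if "l < L" for l
    using c[of "2 * g + l"] that by (simp add: e_def)
  have "differs_by_exact Q L pt
      (poly3 (laurent s (vec_poly (2 * g + 1) h)) * Z3 ^ (2 * t))
      (poly3 (vec_poly (2 * g) z) * Z3 ^ (2 * 0)) (vec_index e)"
  proof (rule differs_by_exact_trans[OF hor[THEN conjunct2, folded s, unfolded shift]
        vertical_reduction[OF assms(6) v z_def]])
    fix l assume l: "l < L"
    have y: "snd (pt l) \<noteq> 0" using assms(5) l by simp
    \<comment> \<open>The horizontal values still lack the factor \<open>y^(1-2t)\<close>. It is
      made up of \<open>y^2\<close> from the first correction, \<open>y^(-2t)\<close> from the
      \<open>t\<close> vertical steps and \<open>y^(-1)\<close> from the last correction.\<close>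
    have "odd_value t y = y ^ 2 / y ^ (2 * t) / y" if "y \<noteq> 0" for y :: "'p padic"
      using that by (cases t) (simp_all add: odd_value_def power2_eq_square power_one_over)
    from this[OF y] show "vec_index e l = (vec_index w (2 * g + 1 + l)
          - fst (pt l) ^ n * vec_index h (2 * g + 1 + l)) * odd_value t (snd (pt l))
        + (vec_index z (2 * g + l) - vec_index v (2 * g + l) / snd (pt l) ^ (2 * t)) / snd (pt l)"
      by (simp only: e_l[OF l] v_l[OF l] hl[OF l]) (simp add: diff_divide_distrib)
  qed
  then obtain G where G: "G \<in> dagger_rat"
      "curve_cong Q (poly3 (laurent s (vec_poly (2 * g + 1) h)) * Z3 ^ (2 * t) - d_series Q G)
        (poly3 (vec_poly (2 * g) z) * Z3 ^ (2 * 0))"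
      "\<And>l. l < L \<Longrightarrow> finite_value G (fst (pt l)) (snd (pt l)) (1 / snd (pt l)) (vec_index e l)"
    unfolding differs_by_exact_def by blast
  have "vec_poly (2 * g) c = vec_poly (2 * g) z"
    by (rule poly_eqI) (simp add: coeff_vec_poly c)
  then have \<omega>': "diff_form Q 0 0 (vec_poly (2 * g) c)
      = dagger_class Q (poly3 (vec_poly (2 * g) z) * Z3 ^ (2 * 0))"
    by (simp add: diff_form_laurent laurent_0)
  have "diff_form Q 0 0 (vec_poly (2 * g) c) = \<omega> \<ominus>\<^bsub>dagger_algebra Q\<^esub> d_dagger Q (dagger_class Q G)"
  proof -
    let ?F = "poly3 (laurent s (vec_poly (2 * g + 1) h)) * Z3 ^ (2 * t)"
    have F: "?F \<in> dagger_rat" "poly3 (vec_poly (2 * g) z) * Z3 ^ (2 * 0) \<in> dagger_rat"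
      by (intro dagger_rat_mult dagger_rat_poly3 dagger_rat_power dagger_rat_generators)+
    have "\<omega> \<ominus>\<^bsub>dagger_algebra Q\<^esub> d_dagger Q (dagger_class Q G) = dagger_class Q (?F - d_series Q G)"
      using F(1) G(1)
      by (simp only: h\<omega> diff_form_laurent d_dagger_class dagger_class_a_minus dagger_rat_d_series)
    also have "\<dots> = dagger_class Q (poly3 (vec_poly (2 * g) z) * Z3 ^ (2 * 0))"
      by (rule dagger_class_eq_iff[THEN iffD2, OF dagger_rat_diff[OF F(1) dagger_rat_d_series[OF G(1)]]
            F(2) G(2)[unfolded curve_cong_def]])
    finally show ?thesis unfolding \<omega>' ..
  qed
  moreover have "dagger_value (dagger_class Q G) (pt l) (vec_index e l)" if "l < L" for l
  proof -
    have "G \<in> dagger_class Q G" using G(1) by (simp add: mem_dagger_class_iff curve_ideal_0)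
    then have "dagger_value (dagger_class Q G) (fst (pt l), snd (pt l)) (vec_index e l)"
      using G(3)[OF that] by (rule dagger_value_finite)
    then show ?thesis by simp
  qed
  moreover have "from_vertical g L Q 0 c = (diff_form Q 0 0 (vec_poly (2 * g) c), e)"
    by (simp add: from_vertical_vec_poly e_def)
  ultimately show ?thesis
    using diff_form_in_W_space[of Q g c] dagger_class_in_carrier[OF G(1), of Q]
    unfolding c_def z_def v_def u_def w_def by blast
qed

end
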